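(* Let $\Omega\subset\mathbf{R}^n$ be a non-empty bounded open set, let $f\in\mathcal{L}_2(\Omega)$ and $g\in W_2^1(\Omega)$. Consider the following two problems for an unknown $u\in W_2^1(\Omega)$. (i) (Minimum problem) $u-g\in\mathring{W}_2^1(\Omega)$, and $u$ minimizes $$w\mapsto \frac12\,\|w\|_\nabla^2-(f|w)_2$$ over all $w\in W_2^1(\Omega)$ with $w-g\in\mathring{W}_2^1(\Omega)$. (ii) (Critical equation) $u-g\in\mathring{W}_2^1(\Omega)$, and $(u|\phi)_\nabla=(f|\phi)_2$ for every $\phi\in\mathring{W}_2^1(\Omega)$. Then each of the problems (i), (ii) has a unique solution, and the two solutions are equal.
   Context: All functions are real-valued. $\mathcal{L}_2(\Omega)$ is the Lebesgue space of square-integrable functions on $\Omega$ (modulo null sets), with scalar product $(u|v)_2=\int_\Omega uv$. $W_2^1(\Omega)$ is the Sobolev space of functions in $\mathcal{L}_2(\Omega)$ whose first-order weak partial derivatives are in $\mathcal{L}_2(\Omega)$. For $u,v\in W_2^1(\Omega)$ put $(u|v)_\nabla=\int_\Omega\sum_{i=1}^n\partial_iu\,\partial_iv$ and $\|u\|_\nabla^2=(u|u)_\nabla$; the scalar product of $W_2^1(\Omega)$ is $(\cdot|\cdot)_{1,2}=(\cdot|\cdot)_2+(\cdot|\cdot)_\nabla$, with norm $\|\cdot\|_{1,2}$. $\mathring{W}_2^1(\Omega)$ is, as usual, the closed subspace of $W_2^1(\Omega)$ of functions vanishing on the border, i.e. the closure of $C_c^\infty(\Omega)$ in $W_2^1(\Omega)$.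 *)

theory Defs
  imports "HOL-Analysis.Analysis"
begin

(* Elements of the spaces below are represented by functions on the whole space of which
   only the values on \<Omega> matter; equality of elements is equality almost everywhere on \<Omega>. *)

definition ae_eq_on :: "'a::euclidean_space set \<Rightarrow> ('a \<Rightarrow> real) \<Rightarrow> ('a \<Rightarrow> real) \<Rightarrow> bool" where
  "ae_eq_on \<Omega> u v \<longleftrightarrow> (AE x in lebesgue_on \<Omega>. u x = v x)"

definition L2 :: "'a::euclidean_space set \<Rightarrow> ('a \<Rightarrow> real) set" where
  "L2 \<Omega> = {u. u \<in> borel_measurable (lebesgue_on \<Omega>) \<and> integrable (lebesgue_on \<Omega>) (\<lambda>x. (u x)\<^sup>2)}"

definition inner_L2 :: "'a::euclidean_space set \<Rightarrow> ('a \<Rightarrow> real) \<Rightarrow> ('a \<Rightarrow> real) \<Rightarrow> real" where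
  "inner_L2 \<Omega> u v = (\<integral>x. u x * v x \<partial>lebesgue_on \<Omega>)"

definition partial_deriv :: "'a::euclidean_space \<Rightarrow> ('a \<Rightarrow> real) \<Rightarrow> 'a \<Rightarrow> real" where
  "partial_deriv b \<phi> x = frechet_derivative \<phi> (at x) b"

primrec Ck :: "nat \<Rightarrow> ('a::euclidean_space \<Rightarrow> real) \<Rightarrow> bool" where
  "Ck 0 \<phi> \<longleftrightarrow> continuous_on UNIV \<phi>"
| "Ck (Suc k) \<phi> \<longleftrightarrow> (\<forall>x. \<phi> differentiable (at x)) \<and> (\<forall>b\<in>Basis. Ck k (partial_deriv b \<phi>))"

(* The space of smooth functions with compact support in \<Omega>, each extended by zero
   outside \<Omega>. *)

definition test_functions :: "'a::euclidean_space set \<Rightarrow> ('a \<Rightarrow> real) set" where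
  "test_functions \<Omega> =
     {\<phi>. (\<forall>k. Ck k \<phi>) \<and> compact (closure {x. \<phi> x \<noteq> 0}) \<and> closure {x. \<phi> x \<noteq> 0} \<subseteq> \<Omega>}"

definition locally_integrable_on :: "('a::euclidean_space \<Rightarrow> real) \<Rightarrow> 'a set \<Rightarrow> bool" where
  "locally_integrable_on u \<Omega> \<longleftrightarrow> (\<forall>K. compact K \<and> K \<subseteq> \<Omega> \<longrightarrow> u absolutely_integrable_on K)"

definition is_weak_partial ::
  "'a::euclidean_space set \<Rightarrow> 'a \<Rightarrow> ('a \<Rightarrow> real) \<Rightarrow> ('a \<Rightarrow> real) \<Rightarrow> bool" where
  "is_weak_partial \<Omega> b u v \<longleftrightarrow>
     locally_integrable_on u \<Omega> \<and> locally_integrable_on v \<Omega> \<and>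
     (\<forall>\<phi>\<in>test_functions \<Omega>.
        (\<integral>x. u x * partial_deriv b \<phi> x \<partial>lebesgue_on \<Omega>) = - (\<integral>x. v x * \<phi> x \<partial>lebesgue_on \<Omega>))"

(* A representative of the weak partial derivative, which is unique up to null sets. *)

definition weak_partial :: "'a::euclidean_space set \<Rightarrow> 'a \<Rightarrow> ('a \<Rightarrow> real) \<Rightarrow> 'a \<Rightarrow> real" where
  "weak_partial \<Omega> b u = (SOME v. is_weak_partial \<Omega> b u v)"

definition W12 :: "'a::euclidean_space set \<Rightarrow> ('a \<Rightarrow> real) set" where
  "W12 \<Omega> = {u \<in> L2 \<Omega>. \<forall>b\<in>Basis. \<exists>v\<in>L2 \<Omega>. is_weak_partial \<Omega> b u v}"

definition inner_grad :: "'a::euclidean_space set \<Rightarrow> ('a \<Rightarrow> real) \<Rightarrow> ('a \<Rightarrow> real) \<Rightarrow> real" where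
  "inner_grad \<Omega> u v =
     (\<integral>x. (\<Sum>b\<in>Basis. weak_partial \<Omega> b u x * weak_partial \<Omega> b v x) \<partial>lebesgue_on \<Omega>)"

definition norm_grad :: "'a::euclidean_space set \<Rightarrow> ('a \<Rightarrow> real) \<Rightarrow> real" where
  "norm_grad \<Omega> u = sqrt (inner_grad \<Omega> u u)"

definition inner_W12 :: "'a::euclidean_space set \<Rightarrow> ('a \<Rightarrow> real) \<Rightarrow> ('a \<Rightarrow> real) \<Rightarrow> real" where
  "inner_W12 \<Omega> u v = inner_L2 \<Omega> u v + inner_grad \<Omega> u v"

definition norm_W12 :: "'a::euclidean_space set \<Rightarrow> ('a \<Rightarrow> real) \<Rightarrow> real" where
  "norm_W12 \<Omega> u = sqrt (inner_W12 \<Omega> u u)"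

definition W12_0 :: "'a::euclidean_space set \<Rightarrow> ('a \<Rightarrow> real) set" where
  "W12_0 \<Omega> =
     {u \<in> W12 \<Omega>. \<forall>\<epsilon>>0. \<exists>\<phi>\<in>test_functions \<Omega>. norm_W12 \<Omega> (\<lambda>x. u x - \<phi> x) < \<epsilon>}"

definition admissible :: "'a::euclidean_space set \<Rightarrow> ('a \<Rightarrow> real) \<Rightarrow> ('a \<Rightarrow> real) set" where
  "admissible \<Omega> g = {w \<in> W12 \<Omega>. (\<lambda>x. w x - g x) \<in> W12_0 \<Omega>}"

definition dirichlet_functional ::
  "'a::euclidean_space set \<Rightarrow> ('a \<Rightarrow> real) \<Rightarrow> ('a \<Rightarrow> real) \<Rightarrow> real" where
  "dirichlet_functional \<Omega> f w = 1 / 2 * (norm_grad \<Omega> w)\<^sup>2 - inner_L2 \<Omega> f w"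

definition solves_minimum_problem ::
  "'a::euclidean_space set \<Rightarrow> ('a \<Rightarrow> real) \<Rightarrow> ('a \<Rightarrow> real) \<Rightarrow> ('a \<Rightarrow> real) \<Rightarrow> bool" where
  "solves_minimum_problem \<Omega> f g u \<longleftrightarrow>
     u \<in> admissible \<Omega> g \<and>
     (\<forall>w\<in>admissible \<Omega> g. dirichlet_functional \<Omega> f u \<le> dirichlet_functional \<Omega> f w)"

definition solves_critical_equation ::
  "'a::euclidean_space set \<Rightarrow> ('a \<Rightarrow> real) \<Rightarrow> ('a \<Rightarrow> real) \<Rightarrow> ('a \<Rightarrow> real) \<Rightarrow> bool" where
  "solves_critical_equation \<Omega> f g u \<longleftrightarrow>
     u \<in> admissible \<Omega> g \<and> (\<forall>\<phi>\<in>W12_0 \<Omega>. inner_grad \<Omega> u \<phi> = inner_L2 \<Omega> f \<phi>)"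

(* Unique existence of an element of W12 modulo null sets: the representatives in W12
   satisfying P form exactly one class under almost-everywhere equality. *)

definition ex1_W12 :: "'a::euclidean_space set \<Rightarrow> (('a \<Rightarrow> real) \<Rightarrow> bool) \<Rightarrow> bool" where
  "ex1_W12 \<Omega> P \<longleftrightarrow> (\<exists>u\<in>W12 \<Omega>. \<forall>v\<in>W12 \<Omega>. P v \<longleftrightarrow> ae_eq_on \<Omega> v u)"

end

theory Submission
  imports Defs
begin

text \<open>
  Difference quotients of a compactly supported function have integral zero by translation
  invariance, so its partial derivatives integrate to zero. Applied to products this is integration by
  parts, and applied to \<open>(x \<bullet> b) \<phi>\<^sup>2\<close> it is the Poincare inequality, first for test functions and
  then, by density, for all functions vanishing on the border. Test functions approximating the
  indicator function of a box, together with Lebesgue differentiation, show that weak derivatives are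
  unique up to null sets, which makes the gradient form bilinear. By the Poincare inequality the
  functional is bounded below, and by the parallelogram identity minimizing sequences are Cauchy;
  completeness yields a minimizer. Varying the minimizer along a line gives the critical equation,
  and the difference of two critical points has gradient zero, hence vanishes by the Poincare
  inequality.
\<close>

section \<open>Smooth bump functions\<close>

text \<open>The shape of the development comes from working with representatives instead of classes.
  \<open>weak_partial\<close> is an arbitrary choice among all weak derivatives, so
  \<open>D b\<close> is linear only up to null sets, and even its square-integrability for
  \<open>u\<close> in \<open>W12\<close> has to be carried over from another representative.
  Uniqueness of weak derivatives therefore precedes all algebra of the gradient form. The gradient
  form is only a seminorm on \<open>W12\<close>. The Poincare inequality makes it control the full
  norm on \<open>W12_0\<close>, and differences of admissible functions lie there; this serves
  coercivity, the Cauchy property and uniqueness alike. Estimates are written for squared norms,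
  with |a + b|^2 \<le> 2 |a|^2 + 2 |b|^2 as a common substitute for the triangle inequality; hence
  the factors 2 and 4. The rate 4^(-k) for squared norms corresponds to 2^(-k) for norms, which is
  summable, so minimizing sequences are chosen with that rate from the start.\<close>

lemma partial_deriv_eqI:
  assumes "(\<phi> has_derivative \<phi>') (at x)"
  shows "partial_deriv b \<phi> x = \<phi>' b"
  using frechet_derivative_at[OF assms] by (simp add: partial_deriv_def)

lemma has_derivative_frechet:
  "\<phi> differentiable (at x) \<Longrightarrow> (\<phi> has_derivative frechet_derivative \<phi> (at x)) (at x)"
  by (simp add: frechet_derivative_works)

lemma partial_deriv_add:
  assumes "\<phi> differentiable (at x)" "\<psi> differentiable (at x)"
  shows "partial_deriv b (\<lambda>x. \<phi> x + \<psi> x) x = partial_deriv b \<phi> x + partial_deriv b \<psi> x"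
  by (rule partial_deriv_eqI[THEN trans])
     (auto intro!: has_derivative_add has_derivative_frechet assms simp: partial_deriv_def)

lemma partial_deriv_mult:
  assumes "\<phi> differentiable (at x)" "\<psi> differentiable (at x)"
  shows "partial_deriv b (\<lambda>x. \<phi> x * \<psi> x) x = \<phi> x * partial_deriv b \<psi> x + partial_deriv b \<phi> x * \<psi> x"
  by (rule partial_deriv_eqI[THEN trans])
     (auto intro!: has_derivative_mult has_derivative_frechet assms simp: partial_deriv_def)

lemma Ck_Suc_imp: "Ck (Suc k) \<phi> \<Longrightarrow> Ck k \<phi>"
  by (induction k arbitrary: \<phi>)
     (auto simp: differentiable_imp_continuous_within continuous_on_eq_continuous_within)

lemma Ck_const: "Ck k (\<lambda>_. c)"
proof (induction k arbitrary: c)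
  case (Suc k)
  have "partial_deriv b (\<lambda>_::'a. c) = (\<lambda>_. 0)" for b
    by (intro ext partial_deriv_eqI[THEN trans]) (auto intro: has_derivative_const)
  then show ?case using Suc by simp
qed auto

lemma Ck_add: "Ck k \<phi> \<Longrightarrow> Ck k \<psi> \<Longrightarrow> Ck k (\<lambda>x. \<phi> x + \<psi> x)"
proof (induction k arbitrary: \<phi> \<psi>)
  case (Suc k)
  have "partial_deriv b (\<lambda>x. \<phi> x + \<psi> x) = (\<lambda>x. partial_deriv b \<phi> x + partial_deriv b \<psi> x)" for b
    using Suc.prems by (auto intro!: ext partial_deriv_add)
  with Suc show ?case by (simp add: differentiable_add)
qed (auto intro: continuous_on_add)

lemma Ck_mult: "Ck k \<phi> \<Longrightarrow> Ck k \<psi> \<Longrightarrow> Ck k (\<lambda>x. \<phi> x * \<psi> x)"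
proof (induction k arbitrary: \<phi> \<psi>)
  case (Suc k)
  have "partial_deriv b (\<lambda>x. \<phi> x * \<psi> x)
      = (\<lambda>x. \<phi> x * partial_deriv b \<psi> x + partial_deriv b \<phi> x * \<psi> x)" for b
    using Suc.prems by (auto intro!: ext partial_deriv_mult)
  \<comment> \<open>Each term of the Leibniz rule keeps one factor undifferentiated, and the
    induction hypothesis wants that factor at order \<open>k\<close>.\<close>
  moreover have "Ck k \<phi>" "Ck k \<psi>"
    using Suc.prems by (auto intro: Ck_Suc_imp)
  ultimately show ?case
    using Suc by (auto intro!: differentiable_mult Ck_add)
qed (auto intro: continuous_on_mult)

lemma Ck_prod: "(\<And>i. i \<in> I \<Longrightarrow> Ck k (\<phi> i)) \<Longrightarrow> Ck k (\<lambda>x. \<Prod>i\<in>I. \<phi> i x)"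
  by (induction I rule: infinite_finite_induct) (auto intro: Ck_const Ck_mult)

text \<open>These functions form a family closed under differentiation.\<close>

definition flat :: "real poly \<Rightarrow> real \<Rightarrow> real" where
  "flat p t = (if t > 0 then poly p (1 / t) * exp (- (1 / t)) else 0)"

lemma poly_times_exp_minus_tendsto_0:
  fixes p :: "real poly"
  shows "((\<lambda>s. poly p s * exp (- s)) \<longlongrightarrow> 0) at_top"
proof -
  have "((\<lambda>s. \<Sum>i\<le>degree p. coeff p i * (s ^ i / exp s)) \<longlongrightarrow> (\<Sum>i\<le>degree p. coeff p i * 0)) at_top"
    by (intro tendsto_sum tendsto_mult_left tendsto_power_div_exp_0)
  then show ?thesis
    by (simp add: poly_altdef exp_minus divide_inverse sum_distrib_right mult.assoc)
qed

lemma flat_tendsto_0: "(flat p \<longlongrightarrow> 0) (at 0)"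
proof -
  have "((\<lambda>t. poly p (inverse t) * exp (- inverse t)) \<longlongrightarrow> 0) (at_right 0)"
    using filterlim_compose[OF poly_times_exp_minus_tendsto_0 filterlim_inverse_at_top_right] by simp
  then have "(flat p \<longlongrightarrow> 0) (at_right 0)"
    by (rule tendsto_cong[THEN iffD1, rotated])
       (auto simp: flat_def eventually_at_right_less divide_inverse intro: eventually_mono[OF eventually_at_right_less])
  moreover have "(flat p \<longlongrightarrow> 0) (at_left 0)"
    by (rule tendsto_cong[THEN iffD1, of "\<lambda>_. 0"])
       (auto simp: flat_def eventually_at_left_field intro!: exI[of _ "-1"])
  ultimately show ?thesis
    by (simp add: filterlim_split_at)
qed

text \<open>With s = 1/t, differentiating p(s) exp(-s) in t gives s^2 (p(s) - p'(s)) exp(-s), which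
  is where the new polynomial comes from. At the gluing point 0 the exponential decay wins over
  every polynomial in s.\<close>

lemma flat_has_real_derivative:
  "(flat p has_real_derivative flat (monom 1 2 * (p - pderiv p)) t) (at t)"
proof (cases t "0::real" rule: linorder_cases)
  case less
  have "((\<lambda>_. 0) has_real_derivative 0) (at t)" by simp
  then have "(flat p has_real_derivative 0) (at t)"
    by (rule has_field_derivative_transform_within_open[of _ _ _ "{..<0}"])
       (use less in \<open>auto simp: flat_def\<close>)
  then show ?thesis using less by (simp add: flat_def)
next
  case greater
  have "((\<lambda>t. poly p (1 / t) * exp (- (1 / t))) has_real_derivative
      flat (monom 1 2 * (p - pderiv p)) t) (at t)"
    using greater
    by (auto intro!: derivative_eq_intros poly_DERIV[THEN DERIV_chain2]
          simp: flat_def poly_monom divide_simps power2_eq_square) (simp add: algebra_simps)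
  then show ?thesis
    by (rule has_field_derivative_transform_within_open[of _ _ _ "{0<..}"])
       (use greater in \<open>auto simp: flat_def\<close>)
next
  case equal
  \<comment> \<open>Division by h multiplies the polynomial by its variable, so the difference
    quotient at 0 belongs to the same family and tends to 0.\<close>
  have "(\<lambda>h. (flat p (0 + h) - flat p 0) / h) = flat (pCons 0 p)"
    by (auto simp: flat_def divide_inverse)
  then have "(flat p has_real_derivative 0) (at 0)"
    using flat_tendsto_0[of "pCons 0 p"] by (simp add: DERIV_def)
  then show ?thesis using equal by (simp add: flat_def)
qed

text \<open>A partial derivative is a constant times the same kind of function with another
  polynomial; the induction therefore has to range over all \<open>p\<close>.\<close>

lemma Ck_flat: "Ck k (\<lambda>x. flat p (x \<bullet> v + c))"
proof (induction k arbitrary: p)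
  case 0
  have "continuous_on UNIV (flat p)" for p
    by (auto simp: continuous_on_eq_continuous_within intro: DERIV_isCont flat_has_real_derivative)
  then show ?case
    unfolding Ck.simps by (rule continuous_on_compose2) (auto intro!: continuous_intros)
next
  case (Suc k)
  have D: "((\<lambda>x. flat p (x \<bullet> v + c)) has_derivative
      (\<lambda>h. flat (monom 1 2 * (p - pderiv p)) (x \<bullet> v + c) * (h \<bullet> v))) (at x)" for x
    by (rule has_derivative_compose[where g="flat p",
          OF _ flat_has_real_derivative[unfolded has_field_derivative_def]])
       (auto intro!: derivative_eq_intros)
  have "partial_deriv b (\<lambda>x. flat p (x \<bullet> v + c)) =
      (\<lambda>x. flat (monom 1 2 * (p - pderiv p)) (x \<bullet> v + c) * (b \<bullet> v))" for b
    by (intro ext partial_deriv_eqI D)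
  with D Suc show ?case
    by (auto intro!: Ck_mult Ck_const simp: differentiable_def)
qed

text \<open>The two factors for direction \<open>i\<close> are positive exactly on the inner sides
  of the two faces orthogonal to \<open>i\<close>. Since \<open>flat 1 s\<close> is exp(-1/s) for s
  > 0, scaling the argument by \<open>Suc m\<close> leaves the set of nonzero values alone and
  pushes the values inside towards 1; the successor keeps the scale positive.\<close>

definition box_bump :: "'a::euclidean_space \<Rightarrow> 'a \<Rightarrow> nat \<Rightarrow> 'a \<Rightarrow> real" where
  "box_bump a c m x = (\<Prod>i\<in>Basis. flat 1 (real (Suc m) * (x \<bullet> i - a \<bullet> i)) * flat 1 (real (Suc m) * (c \<bullet> i - x \<bullet> i)))"

lemma Ck_box_bump: "Ck k (box_bump a c m)"
proof -
  have 1: "Ck k (\<lambda>x. flat 1 (real (Suc m) * (x \<bullet> i - a \<bullet> i)))" for i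
    using Ck_flat[of k 1 "real (Suc m) *\<^sub>R i" "- real (Suc m) * (a \<bullet> i)"]
    by (simp add: algebra_simps)
  have 2: "Ck k (\<lambda>x. flat 1 (real (Suc m) * (c \<bullet> i - x \<bullet> i)))" for i
    using Ck_flat[of k 1 "- real (Suc m) *\<^sub>R i" "real (Suc m) * (c \<bullet> i)"]
    by (simp add: algebra_simps)
  show ?thesis
    unfolding box_bump_def by (intro Ck_prod Ck_mult 1 2)
qed

lemma flat_1_bounds: "0 \<le> flat 1 t" "flat 1 t \<le> 1" "flat 1 t \<noteq> 0 \<longleftrightarrow> t > 0"
  by (auto simp: flat_def)

lemma box_bump_bounds: "0 \<le> box_bump a c m x" "box_bump a c m x \<le> 1"
  unfolding box_bump_def
  by (auto intro!: prod_nonneg prod_le_1 mult_nonneg_nonneg mult_le_one flat_1_bounds)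

lemma box_bump_nonzero_iff: "box_bump a c m x \<noteq> 0 \<longleftrightarrow> x \<in> box a c"
  by (auto simp: box_bump_def flat_1_bounds mem_box zero_less_mult_iff)

lemma box_bump_in_test_functions:
  assumes "cbox a c \<subseteq> \<Omega>"
  shows "box_bump a c m \<in> test_functions \<Omega>"
proof -
  have "closure (box a c) \<subseteq> cbox a c"
    by (intro closure_minimal box_subset_cbox closed_cbox)
  moreover have "compact (closure (box a c))"
    by (simp add: bounded_box)
  ultimately show ?thesis
    using assms by (auto simp: test_functions_def Ck_box_bump box_bump_nonzero_iff)
qed

lemma box_bump_tendsto_indicator: "(\<lambda>m. box_bump a c m x) \<longlonglongrightarrow> indicator (box a c) x"
proof (cases "x \<in> box a c")
  case True
  have *: "(\<lambda>m. flat 1 (real (Suc m) * t)) \<longlonglongrightarrow> 1" if "t > 0" for t :: real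
  proof -
    have "(\<lambda>m. exp (- ((1 / t) * inverse (real (Suc m))))) \<longlonglongrightarrow> exp (- ((1 / t) * 0))"
      by (intro tendsto_intros LIMSEQ_inverse_real_of_nat)
    then show ?thesis using that by (simp add: flat_def divide_inverse mult.commute)
  qed
  have "(\<lambda>m. box_bump a c m x) \<longlonglongrightarrow> (\<Prod>i\<in>(Basis::'a set). 1 * 1)"
    unfolding box_bump_def using True
    by (intro tendsto_prod tendsto_mult *) (auto simp: mem_box)
  then show ?thesis using True by simp
next
  case False
  then have "box_bump a c m x = 0" for m
    using box_bump_nonzero_iff by blast
  then show ?thesis using False by simp
qed

section \<open>Integration by parts\<close>

lemma integrable_lborel_compact_support:
  fixes f :: "'a::euclidean_space \<Rightarrow> real"
  assumes "continuous_on UNIV f" "compact K" "\<And>x. x \<notin> K \<Longrightarrow> f x = 0"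
  shows "integrable lborel f"
proof -
  have "integrable lborel (\<lambda>x. indicator K x *\<^sub>R f x)"
    using assms by (intro borel_integrable_compact) (auto intro: continuous_on_subset)
  moreover have "(\<lambda>x. indicator K x *\<^sub>R f x) = f"
  proof
    show "indicator K x *\<^sub>R f x = f x" for x
      using assms(3)[of x] by (cases "x \<in> K") auto
  qed
  ultimately show ?thesis by simp
qed

lemma partial_deriv_outside_support:
  assumes "x \<notin> closure {x. \<phi> x \<noteq> 0}"
  shows "partial_deriv b \<phi> x = 0"
proof -
  have "((\<lambda>_. 0) has_derivative (\<lambda>_. 0)) (at x)" by simp
  then have "(\<phi> has_derivative (\<lambda>_. 0)) (at x)"
    by (rule has_derivative_transform_within_open[of _ _ _ _ "- closure {x. \<phi> x \<noteq> 0}"])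
       (use assms closure_subset[of "{x. \<phi> x \<noteq> 0}"] in auto)
  then show ?thesis by (simp add: partial_deriv_eqI)
qed

lemma has_real_derivative_along_line:
  assumes "\<psi> differentiable (at (x + s *\<^sub>R b))"
  shows "((\<lambda>s. \<psi> (x + s *\<^sub>R b)) has_real_derivative partial_deriv b \<psi> (x + s *\<^sub>R b)) (at s)"
proof -
  have l: "((\<lambda>s. x + s *\<^sub>R b) has_derivative (\<lambda>h. h *\<^sub>R b)) (at s)"
    by (auto intro!: derivative_eq_intros)
  have "((\<lambda>s. \<psi> (x + s *\<^sub>R b)) has_derivative
      (\<lambda>h. frechet_derivative \<psi> (at (x + s *\<^sub>R b)) (h *\<^sub>R b))) (at s)"
    by (rule has_derivative_compose[OF l has_derivative_frechet[OF assms]])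
  moreover have "(\<lambda>h. frechet_derivative \<psi> (at (x + s *\<^sub>R b)) (h *\<^sub>R b)) =
      (*) (partial_deriv b \<psi> (x + s *\<^sub>R b))"
    using linear_frechet_derivative[OF assms] by (auto simp: partial_deriv_def linear_scale)
  ultimately show ?thesis by (simp add: has_field_derivative_def)
qed

lemma integral_lborel_translate:
  fixes f :: "'a::euclidean_space \<Rightarrow> real"
  assumes "integrable lborel f"
  shows "integrable lborel (\<lambda>x. f (x + a))" "(\<integral>x. f (x + a) \<partial>lborel) = (\<integral>x. f x \<partial>lborel)"
proof -
  have [measurable]: "f \<in> borel_measurable borel"
    using borel_measurable_integrable[OF assms] by simp
  have "integrable (distr lborel borel ((+) a)) f"
    using assms by (simp add: lborel_distr_plus)
  then show "integrable lborel (\<lambda>x. f (x + a))"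
    by (subst (asm) integrable_distr_eq) (auto simp: add.commute)
  have "(\<integral>x. f x \<partial>distr lborel borel ((+) a)) = (\<integral>x. f (x + a) \<partial>lborel)"
    by (subst integral_distr) (auto simp: add.commute)
  then show "(\<integral>x. f (x + a) \<partial>lborel) = (\<integral>x. f x \<partial>lborel)"
    by (simp add: lborel_distr_plus)
qed

text \<open>Difference quotients have integral zero by translation invariance and, by the mean value
  theorem, are uniformly bounded, so dominated convergence applies.\<close>

lemma integral_partial_deriv_eq_0:
  fixes \<psi> :: "'a::euclidean_space \<Rightarrow> real"
  assumes diff: "\<And>x. \<psi> differentiable (at x)"
    and cont: "continuous_on UNIV (partial_deriv b \<psi>)"
    and supp: "bounded {x. \<psi> x \<noteq> 0}"
  shows "(\<integral>x. partial_deriv b \<psi> x \<partial>lborel) = 0"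
proof -
  define D where "D = partial_deriv b \<psi>"
  obtain R where "{x. \<psi> x \<noteq> 0} \<subseteq> cball 0 R"
    using bounded_subset_ballD[OF supp, of 0] ball_subset_cball by blast
  then have R: "\<psi> x = 0" if "x \<notin> cball 0 R" for x
    using that by blast
  have "closure {x. \<psi> x \<noteq> 0} \<subseteq> cball 0 R"
    using \<open>{x. \<psi> x \<noteq> 0} \<subseteq> cball 0 R\<close> by (intro closure_minimal) auto
  then have D0: "D x = 0" if "x \<notin> cball 0 R" for x
    unfolding D_def using that by (intro partial_deriv_outside_support) auto
  have "bounded (D ` cball 0 R)"
    unfolding D_def
    by (intro compact_imp_bounded compact_continuous_image continuous_on_subset[OF cont]) auto
  then obtain B0 where "\<forall>y \<in> D ` cball 0 R. norm y \<le> B0"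
    unfolding bounded_iff by blast
  then have B0: "\<bar>D x\<bar> \<le> B0" if "x \<in> cball 0 R" for x
    using that by force
  \<comment> \<open>The maximum keeps the bound nonnegative even for an empty ball, where
    \<open>B0\<close> is arbitrary.\<close>
  define B where "B = max B0 0"
  have B: "\<bar>D x\<bar> \<le> B" "0 \<le> B" for x
    using B0[of x] D0[of x] by (cases "x \<in> cball 0 R"; simp add: B_def le_max_iff_disj)+
  note line = has_real_derivative_along_line[OF diff, where b=b, folded D_def]
  have lip: "\<bar>\<psi> (x + h *\<^sub>R b) - \<psi> x\<bar> \<le> B * h" if h0: "h > 0" for x h
  proof -
    obtain z where "\<psi> (x + h *\<^sub>R b) - \<psi> (x + 0 *\<^sub>R b) = (h - 0) * D (x + z *\<^sub>R b)"
      using MVT2[of 0 h "\<lambda>s. \<psi> (x + s *\<^sub>R b)" "\<lambda>s. D (x + s *\<^sub>R b)", OF h0 line] by blast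
    then show ?thesis
      using B(1)[of "x + z *\<^sub>R b"] that by (simp add: abs_mult mult.commute mult_left_mono)
  qed
  have cont\<psi>: "continuous_on UNIV \<psi>"
    using diff by (auto simp: continuous_on_eq_continuous_within differentiable_imp_continuous_within)
  have int\<psi>: "integrable lborel \<psi>"
    by (rule integrable_lborel_compact_support[OF cont\<psi> compact_cball R])
  have meas\<psi>: "\<psi> \<in> borel_measurable lborel"
    using borel_measurable_integrable[OF int\<psi>] .
  have dmeas: "(\<lambda>x. \<psi> (x + a)) \<in> borel_measurable lborel" for a
    using borel_measurable_integrable[OF integral_lborel_translate(1)[OF int\<psi>]] .
  define h where "h m = inverse (real (Suc m))" for m
  have h: "h m > 0" "h m \<le> 1" for m by (auto simp: h_def field_simps)
  define d where "d m x = (\<psi> (x + h m *\<^sub>R b) - \<psi> x) / h m" for m x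
  have dint: "(\<integral>x. d m x \<partial>lborel) = 0" for m
    using integral_lborel_translate[OF int\<psi>, of "h m *\<^sub>R b"] int\<psi> by (simp add: d_def)
  have "(\<lambda>m. \<integral>x. d m x \<partial>lborel) \<longlonglongrightarrow> (\<integral>x. D x \<partial>lborel)"
  \<comment> \<open>Steps are at most 1, so all quotients vanish outside the ball enlarged by
    \<open>norm b\<close>; inside it the Lipschitz bound \<open>B\<close> applies. This is one
    integrable majorant for all \<open>m\<close>.\<close>
  proof (rule integral_dominated_convergence[where w="\<lambda>x. B * indicator (cball 0 (R + norm b)) x"])
    show "D \<in> borel_measurable lborel"
      using cont by (simp add: D_def borel_measurable_continuous_onI)
    show "d m \<in> borel_measurable lborel" for m
      unfolding d_def[abs_def] using cont\<psi>
      by (intro borel_measurable_divide borel_measurable_diff borel_measurable_const dmeas meas\<psi>)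
    show "integrable lborel (\<lambda>x. B * indicator (cball 0 (R + norm b)) x)"
      by (intro integrable_mult_right integrable_real_indicator emeasure_bounded_finite bounded_cball) simp
    have "(\<lambda>m. d m x) \<longlonglongrightarrow> D x" for x
    proof -
      have "((\<lambda>s. (\<psi> (x + s *\<^sub>R b) - \<psi> x) / s) \<longlongrightarrow> D x) (at 0)"
        using line[of x 0] by (simp add: DERIV_def)
      moreover have "filterlim h (at 0) sequentially"
        using LIMSEQ_inverse_real_of_nat h(1)
        by (auto simp: filterlim_at h_def[abs_def])
      ultimately show ?thesis
        unfolding d_def by (rule filterlim_compose)
    qed
    then show "AE x in lborel. (\<lambda>m. d m x) \<longlonglongrightarrow> D x" by simp
    have "norm (d m x) \<le> B * indicator (cball 0 (R + norm b)) x" for m x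
    proof (cases "x \<in> cball 0 (R + norm b)")
      case True
      then show ?thesis using lip[OF h(1)[of m], of x] h[of m] by (simp add: d_def field_simps)
    next
      case False
      have "norm x \<le> norm (x + h m *\<^sub>R b) + norm (h m *\<^sub>R b)"
        using norm_triangle_ineq4[of "x + h m *\<^sub>R b" "h m *\<^sub>R b"] by simp
      also have "norm (h m *\<^sub>R b) \<le> norm b"
        using h[of m] by (simp add: mult_left_le_one_le)
      finally have "x + h m *\<^sub>R b \<notin> cball 0 R" "x \<notin> cball 0 R"
        using False norm_ge_zero[of b] by (auto simp del: norm_ge_zero)
      then show ?thesis using False R by (simp add: d_def)
    qed
    then show "AE x in lborel. norm (d m x) \<le> B * indicator (cball 0 (R + norm b)) x" for m by simp
  qed
  then show ?thesis
    by (simp add: dint D_def LIMSEQ_const_iff)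
qed

lemma test_functionsD:
  assumes "\<phi> \<in> test_functions \<Omega>"
  shows "Ck k \<phi>" "\<phi> differentiable (at x)" "continuous_on UNIV \<phi>"
    "b \<in> Basis \<Longrightarrow> continuous_on UNIV (partial_deriv b \<phi>)"
    "compact (closure {x. \<phi> x \<noteq> 0})" "closure {x. \<phi> x \<noteq> 0} \<subseteq> \<Omega>"
    "x \<notin> closure {x. \<phi> x \<noteq> 0} \<Longrightarrow> \<phi> x = 0"
proof -
  have C: "Ck k \<phi>" for k using assms by (simp add: test_functions_def)
  show "Ck k \<phi>" "\<phi> differentiable (at x)" "continuous_on UNIV \<phi>"
    "b \<in> Basis \<Longrightarrow> continuous_on UNIV (partial_deriv b \<phi>)"
    using C[of k] C[of 1] C[of 0] by auto
  show "compact (closure {x. \<phi> x \<noteq> 0})" "closure {x. \<phi> x \<noteq> 0} \<subseteq> \<Omega>"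
    using assms by (auto simp: test_functions_def)
  show "x \<notin> closure {x. \<phi> x \<noteq> 0} \<Longrightarrow> \<phi> x = 0"
    using closure_subset[of "{x. \<phi> x \<noteq> 0}"] by blast
qed

lemma integration_by_parts_test_functions:
  assumes "\<phi> \<in> test_functions \<Omega>" "\<psi> \<in> test_functions \<Omega>'" "b \<in> Basis"
  shows "(\<integral>x. \<phi> x * partial_deriv b \<psi> x \<partial>lborel) = - (\<integral>x. partial_deriv b \<phi> x * \<psi> x \<partial>lborel)"
proof -
  note t1 = test_functionsD[OF assms(1)] and t2 = test_functionsD[OF assms(2)]
  have D: "partial_deriv b (\<lambda>x. \<phi> x * \<psi> x) = (\<lambda>x. \<phi> x * partial_deriv b \<psi> x + partial_deriv b \<phi> x * \<psi> x)"
    by (intro ext partial_deriv_mult t1(2) t2(2))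
  have "(\<integral>x. partial_deriv b (\<lambda>x. \<phi> x * \<psi> x) x \<partial>lborel) = 0"
  proof (rule integral_partial_deriv_eq_0)
    show "continuous_on UNIV (partial_deriv b (\<lambda>x. \<phi> x * \<psi> x))"
      unfolding D by (intro continuous_on_add continuous_on_mult t1(3) t2(3) t1(4) t2(4) assms(3))
    have "bounded {x. \<phi> x \<noteq> 0}"
      using compact_imp_bounded[OF t1(5)] closure_subset bounded_subset by blast
    then show "bounded {x. \<phi> x * \<psi> x \<noteq> 0}"
      by (rule bounded_subset) auto
  qed (intro differentiable_mult t1(2) t2(2))
  moreover have "integrable lborel (\<lambda>x. \<phi> x * partial_deriv b \<psi> x)"
    by (rule integrable_lborel_compact_support[OF continuous_on_mult[OF t1(3) t2(4)[OF assms(3)]] t1(5)])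
       (drule t1(7), simp)
  moreover have "integrable lborel (\<lambda>x. partial_deriv b \<phi> x * \<psi> x)"
    by (rule integrable_lborel_compact_support[OF continuous_on_mult[OF t1(4)[OF assms(3)] t2(3)] t2(5)])
       (drule t2(7), simp)
  ultimately show ?thesis by (simp add: D)
qed

text \<open>Integrating the derivative of \<open>(x \<bullet> b) \<phi>\<^sup>2\<close> expresses the integral of \<open>\<phi>\<^sup>2\<close> through
  \<open>\<phi>\<close> times its derivative.\<close>

lemma Poincare_test_functions:
  assumes "\<phi> \<in> test_functions \<Omega>" "b \<in> Basis" "\<And>x. x \<in> \<Omega> \<Longrightarrow> \<bar>x \<bullet> b\<bar> \<le> R"
  shows "(\<integral>x. (\<phi> x)\<^sup>2 \<partial>lborel) \<le> 4 * R\<^sup>2 * (\<integral>x. (partial_deriv b \<phi> x)\<^sup>2 \<partial>lborel)"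
proof -
  note t = test_functionsD[OF assms(1)]
  define D where "D = partial_deriv b \<phi>"
  have D0: "D x = 0" if "x \<notin> closure {x. \<phi> x \<noteq> 0}" for x
    using that by (simp add: D_def partial_deriv_outside_support)
  have contD: "continuous_on UNIV D" using t(4)[OF assms(2)] by (simp add: D_def)
  have lin: "((\<lambda>x. x \<bullet> b) has_derivative (\<lambda>h. h \<bullet> b)) (at x)" for x
    by (auto intro!: derivative_eq_intros)
  have *: "partial_deriv b (\<lambda>x. (x \<bullet> b) * (\<phi> x * \<phi> x)) = (\<lambda>x. (\<phi> x)\<^sup>2 + 2 * (x \<bullet> b) * \<phi> x * D x)"
  proof
    fix x
    have "partial_deriv b (\<lambda>x. (x \<bullet> b) * (\<phi> x * \<phi> x)) x =
        (x \<bullet> b) * partial_deriv b (\<lambda>x. \<phi> x * \<phi> x) x + partial_deriv b (\<lambda>x. x \<bullet> b) x * (\<phi> x * \<phi> x)"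
      using lin t(2) by (intro partial_deriv_mult differentiable_mult) (auto simp: differentiable_def)
    also have "partial_deriv b (\<lambda>x. x \<bullet> b) x = 1"
      using partial_deriv_eqI[OF lin] assms(2) by (simp add: inner_same_Basis)
    finally show "partial_deriv b (\<lambda>x. (x \<bullet> b) * (\<phi> x * \<phi> x)) x = (\<phi> x)\<^sup>2 + 2 * (x \<bullet> b) * \<phi> x * D x"
      using partial_deriv_mult[OF t(2) t(2), of b x] by (simp add: D_def power2_eq_square algebra_simps)
  qed
  have "(\<integral>x. partial_deriv b (\<lambda>x. (x \<bullet> b) * (\<phi> x * \<phi> x)) x \<partial>lborel) = 0"
  proof (rule integral_partial_deriv_eq_0)
    show "(\<lambda>x. (x \<bullet> b) * (\<phi> x * \<phi> x)) differentiable (at x)" for x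
      using lin t(2) by (intro differentiable_mult) (auto simp: differentiable_def)
    show "continuous_on UNIV (partial_deriv b (\<lambda>x. (x \<bullet> b) * (\<phi> x * \<phi> x)))"
      unfolding * by (intro continuous_intros t(3) contD)
    have "bounded {x. \<phi> x \<noteq> 0}"
      using compact_imp_bounded[OF t(5)] closure_subset bounded_subset by blast
    then show "bounded {x. x \<bullet> b * (\<phi> x * \<phi> x) \<noteq> 0}"
      by (rule bounded_subset) auto
  qed
  moreover have i: "integrable lborel (\<lambda>x. (\<phi> x)\<^sup>2)" "integrable lborel (\<lambda>x. 2 * (x \<bullet> b) * \<phi> x * D x)"
     "integrable lborel (\<lambda>x. (D x)\<^sup>2)"
    by (rule integrable_lborel_compact_support[OF _ t(5)];
        (intro continuous_intros t(3) contD | frule t(7), drule D0, simp))+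
  ultimately have "(\<integral>x. (\<phi> x)\<^sup>2 \<partial>lborel) = (\<integral>x. - (2 * (x \<bullet> b) * \<phi> x * D x) \<partial>lborel)"
    by (simp add: *)
  also have "\<dots> \<le> (\<integral>x. 1/2 * (\<phi> x)\<^sup>2 + 2 * R\<^sup>2 * (D x)\<^sup>2 \<partial>lborel)"
  proof (rule integral_mono)
    fix x
    show "- (2 * (x \<bullet> b) * \<phi> x * D x) \<le> 1/2 * (\<phi> x)\<^sup>2 + 2 * R\<^sup>2 * (D x)\<^sup>2"
    proof (cases "x \<in> \<Omega>")
      case True
      \<comment> \<open>The weights of this square leave the coefficient 1/2 in front of
        \<open>(\<phi> x)\<^sup>2\<close>. That half is absorbed by the left-hand side after
        integration, which doubles 2 R^2 to the final 4 R^2.\<close>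
      have "0 \<le> (\<phi> x + 2 * (x \<bullet> b) * D x)\<^sup>2" by simp
      then have "- (2 * (x \<bullet> b) * \<phi> x * D x) \<le> 1/2 * (\<phi> x)\<^sup>2 + 2 * (x \<bullet> b)\<^sup>2 * (D x)\<^sup>2"
        by (simp add: power2_eq_square algebra_simps)
      moreover have "(x \<bullet> b)\<^sup>2 * (D x)\<^sup>2 \<le> R\<^sup>2 * (D x)\<^sup>2"
        using assms(3)[OF True] by (intro mult_right_mono power2_le_iff_abs_le[THEN iffD2]) auto
      ultimately show ?thesis by linarith
    next
      case False
      then have "x \<notin> closure {x. \<phi> x \<noteq> 0}" using t(6) by blast
      then show ?thesis using t(7)[of x] D0[of x] by simp
    qed
  qed (use i in auto)
  also have "\<dots> = 1/2 * (\<integral>x. (\<phi> x)\<^sup>2 \<partial>lborel) + 2 * R\<^sup>2 * (\<integral>x. (D x)\<^sup>2 \<partial>lborel)"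
    using i by simp
  finally show ?thesis by (simp add: D_def)
qed

lemma test_functions_add_cmult:
  assumes "\<phi> \<in> test_functions \<Omega>" "\<psi> \<in> test_functions \<Omega>"
  shows "(\<lambda>x. \<phi> x + c * \<psi> x) \<in> test_functions \<Omega>"
proof -
  note t1 = test_functionsD[OF assms(1)] and t2 = test_functionsD[OF assms(2)]
  let ?K = "closure {x. \<phi> x \<noteq> 0} \<union> closure {x. \<psi> x \<noteq> 0}"
  have "{x. \<phi> x + c * \<psi> x \<noteq> 0} \<subseteq> ?K"
  proof
    fix x assume "x \<in> {x. \<phi> x + c * \<psi> x \<noteq> 0}"
    then have "\<phi> x \<noteq> 0 \<or> \<psi> x \<noteq> 0" by auto
    then show "x \<in> ?K" using t1(7)[of x] t2(7)[of x] by blast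
  qed
  note sub = this
  then have *: "closure {x. \<phi> x + c * \<psi> x \<noteq> 0} \<subseteq> ?K"
    by (intro closure_minimal) auto
  moreover have "compact ?K" using t1(5) t2(5) by (rule compact_Un)
  ultimately have "compact (closure {x. \<phi> x + c * \<psi> x \<noteq> 0})"
    using bounded_subset[OF compact_imp_bounded sub] by simp
  moreover have "Ck k (\<lambda>x. \<phi> x + c * \<psi> x)" for k
    by (intro Ck_add Ck_mult Ck_const t1(1) t2(1))
  ultimately show ?thesis
    using t1(6) t2(6) * unfolding test_functions_def by blast
qed

text \<open>Bridge between the restricted Lebesgue measure of the definitions and
  \<open>lborel\<close>, over which integration by parts is carried out; extension by zero makes the
  restriction invisible.\<close>

lemma integral_lebesgue_on_eq_lborel:
  fixes f :: "'a::euclidean_space \<Rightarrow> real"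
  assumes "S \<in> sets lebesgue" "f \<in> borel_measurable borel" "\<And>x. x \<notin> S \<Longrightarrow> f x = 0"
  shows "(\<integral>x. f x \<partial>lebesgue_on S) = (\<integral>x. f x \<partial>lborel)"
proof -
  have "(\<lambda>x. indicator S x *\<^sub>R f x) = f"
  proof
    show "indicator S x *\<^sub>R f x = f x" for x
      using assms(3)[of x] by (cases "x \<in> S") auto
  qed
  then show ?thesis
    using assms by (simp add: integral_restrict_space integral_completion)
qed

section \<open>The fundamental lemma of the calculus of variations\<close>

lemma AE_lebesgue_on_negligibleI:
  assumes "S \<in> sets lebesgue" "negligible {x \<in> S. \<not> P x}"
  shows "AE x in lebesgue_on S. P x"
proof -
  have "AE x in lebesgue. x \<in> S \<longrightarrow> P x"
    using assms(2) by (intro AE_I'[of "{x \<in> S. \<not> P x}"]) (auto simp: negligible_iff_null_sets)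
  then show ?thesis
    using assms(1) by (simp add: AE_restrict_space_iff)
qed

text \<open>The bumps of a closed box inside \<open>\<Omega>\<close> are test functions and tend to
  the indicator of the open box, so dominated convergence carries the orthogonality over to that
  indicator. The faces of the box are null.\<close>

lemma integral_cbox_eq_0_if_orthogonal_test_functions:
  fixes w :: "'a::euclidean_space \<Rightarrow> real"
  assumes "open \<Omega>" and lint: "locally_integrable_on w \<Omega>"
    and orth: "\<And>\<phi>. \<phi> \<in> test_functions \<Omega> \<Longrightarrow> (\<integral>x. w x * \<phi> x \<partial>lebesgue_on \<Omega>) = 0"
    and sub: "cbox a c \<subseteq> \<Omega>"
  shows "integral (cbox a c) w = 0"
proof -
  have w: "set_integrable lebesgue (cbox a c) w"
    using lint sub by (simp add: locally_integrable_on_def compact_cbox)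
  \<comment> \<open>Only local integrability of \<open>w\<close> is known, so a majorant over all of
    \<open>\<Omega>\<close> need not exist. The truncation is integrable and agrees with
    \<open>w\<close> wherever the bumps are nonzero.\<close>
  define W where "W x = indicator (cbox a c) x *\<^sub>R w x" for x
  have W: "integrable lebesgue W"
    using w by (simp add: W_def[abs_def] set_integrable_def)
  have Om: "\<Omega> \<in> sets lebesgue"
    using \<open>open \<Omega>\<close> by simp
  have 0: "(\<integral>x. W x * box_bump a c m x \<partial>lebesgue) = 0" for m
  proof -
    have "indicator \<Omega> x *\<^sub>R (w x * box_bump a c m x) = W x * box_bump a c m x" for x
      using sub box_bump_nonzero_iff[of a c m x] box_subset_cbox[of a c]
      by (cases "x \<in> box a c") (auto simp: W_def indicator_def split: if_splits)
    then have *: "(\<lambda>x. W x * box_bump a c m x) = (\<lambda>x. indicator \<Omega> x *\<^sub>R (w x * box_bump a c m x))"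
      by (intro ext) (rule sym)
    have "(\<integral>x. W x * box_bump a c m x \<partial>lebesgue) = (\<integral>x. w x * box_bump a c m x \<partial>lebesgue_on \<Omega>)"
      unfolding * by (rule integral_restrict_space[symmetric]) (use Om in simp)
    then show ?thesis
      using orth[OF box_bump_in_test_functions[OF sub]] by simp
  qed
  have bm: "box_bump a c m \<in> borel_measurable lebesgue" for m
  proof -
    have "continuous_on UNIV (box_bump a c m)" using Ck_box_bump[of 0 a c m] by simp
    then have "box_bump a c m \<in> borel_measurable borel"
      by (rule borel_measurable_continuous_onI)
    then show ?thesis
      by (intro measurable_completion) simp
  qed
  have "(\<lambda>m. \<integral>x. W x * box_bump a c m x \<partial>lebesgue) \<longlonglongrightarrow> (\<integral>x. W x * indicator (box a c) x \<partial>lebesgue)"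
  proof (rule integral_dominated_convergence[where w="\<lambda>x. \<bar>W x\<bar>"])
    show "AE x in lebesgue. (\<lambda>m. W x * box_bump a c m x) \<longlonglongrightarrow> W x * indicator (box a c) x"
      by (intro always_eventually allI tendsto_mult_left box_bump_tendsto_indicator)
    have "\<bar>W x\<bar> * \<bar>box_bump a c m x\<bar> \<le> \<bar>W x\<bar>" for m x
      using box_bump_bounds[of a c m x] by (intro mult_left_le) auto
    then show "AE x in lebesgue. norm (W x * box_bump a c m x) \<le> \<bar>W x\<bar>" for m
      by (intro always_eventually allI) (simp add: abs_mult)
    show "(\<lambda>x. W x * box_bump a c m x) \<in> borel_measurable lebesgue" for m
      by (intro borel_measurable_times borel_measurable_integrable[OF W] bm)
    show "(\<lambda>x. W x * indicator (box a c) x) \<in> borel_measurable lebesgue"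
      by (intro borel_measurable_times borel_measurable_integrable[OF W] borel_measurable_indicator) simp
  qed (use W in simp)
  then have "(\<integral>x. W x * indicator (box a c) x \<partial>lebesgue) = 0"
    by (simp add: 0 LIMSEQ_const_iff)
  moreover have "W x * indicator (box a c) x = indicator (box a c) x *\<^sub>R w x" for x
    using box_subset_cbox[of a c] by (cases "x \<in> box a c") (auto simp: W_def)
  ultimately have "set_lebesgue_integral lebesgue (box a c) w = 0"
    by (simp add: set_lebesgue_integral_def)
  moreover have "set_integrable lebesgue (box a c) w"
    by (rule set_integrable_subset[OF w]) (auto simp: box_subset_cbox)
  ultimately have "integral (box a c) w = 0"
    using set_lebesgue_integral_eq_integral(2) by metis
  then show ?thesis by (simp add: integral_open_interval)
qed

text \<open>By Lebesgue differentiation the averages over small cubes with lower corner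
  \<open>x\<close> tend to the value at \<open>x\<close>, for almost every \<open>x\<close>. In the
  open box small cubes stay inside, so these averages are 0; the boundary of the box is
  null.\<close>

lemma negligible_if_integrals_cbox_eq_0:
  fixes w :: "'a::euclidean_space \<Rightarrow> real"
  assumes int: "w absolutely_integrable_on cbox a c"
    and zero: "\<And>u v. cbox u v \<subseteq> cbox a c \<Longrightarrow> integral (cbox u v) w = 0"
  shows "negligible {x \<in> cbox a c. w x \<noteq> 0}"
proof -
  \<comment> \<open>The differentiation theorem is applied to a function integrable over every box
    of the space, hence the extension by zero.\<close>
  define F where "F x = (if x \<in> cbox a c then w x else 0)" for x
  have "F integrable_on UNIV"
    using int by (simp add: F_def[abs_def] integrable_restrict_UNIV absolutely_integrable_on_def)
  then have "F integrable_on cbox u v" for u v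
    by (rule integrable_on_subcbox) simp
  then obtain N where N: "negligible N" and dens: "\<And>x e. \<lbrakk>x \<notin> N; 0 < e\<rbrakk> \<Longrightarrow>
      \<exists>d>0. \<forall>h. 0 < h \<and> h < d \<longrightarrow> norm (integral (cbox x (x + h *\<^sub>R One)) F /\<^sub>R h ^ DIM('a) - F x) < e"
    using integrable_ccontinuous_explicit[of F] by blast
  have "w x = 0" if x: "x \<in> box a c" "x \<notin> N" for x
  proof (rule ccontr)
    assume "w x \<noteq> 0"
    \<comment> \<open>The precision |w x| is chosen so that a vanishing average yields |w x| < |w
      x|.\<close>
    then obtain d where d: "d > 0" "\<And>h. 0 < h \<Longrightarrow> h < d \<Longrightarrow>
        norm (integral (cbox x (x + h *\<^sub>R One)) F /\<^sub>R h ^ DIM('a) - F x) < \<bar>w x\<bar>"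
      using dens[OF x(2), of "\<bar>w x\<bar>"] by auto
    have "\<forall>\<^sub>F h in at_right 0. x \<bullet> i + h < c \<bullet> i" if "i \<in> Basis" for i
      using eventually_at_right_less[of 0] x that
      by (auto simp: eventually_at_right_field mem_box intro!: exI[of _ "c \<bullet> i - x \<bullet> i"])
    then have "\<forall>\<^sub>F h in at_right 0. \<forall>i\<in>Basis. x \<bullet> i + h < c \<bullet> i"
      by (intro eventually_ball_finite) auto
    moreover have "\<forall>\<^sub>F h in at_right 0. 0 < h \<and> h < d"
      using d(1) by (auto simp: eventually_at_right_field)
    ultimately have "\<forall>\<^sub>F h in at_right 0. (\<forall>i\<in>Basis. x \<bullet> i + h < c \<bullet> i) \<and> 0 < h \<and> h < d"
      by (rule eventually_conj)
    then obtain h where h: "\<And>i. i \<in> Basis \<Longrightarrow> x \<bullet> i + h < c \<bullet> i" "0 < h" "h < d"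
      using eventually_happens by (metis (mono_tags, lifting) trivial_limit_at_right_real)
    have sub: "cbox x (x + h *\<^sub>R One) \<subseteq> cbox a c"
    proof
      fix y assume y: "y \<in> cbox x (x + h *\<^sub>R One)"
      show "y \<in> cbox a c"
        unfolding mem_box
      proof (intro ballI conjI)
        fix i :: 'a assume i: "i \<in> Basis"
        have "x \<bullet> i \<le> y \<bullet> i" "y \<bullet> i \<le> x \<bullet> i + h"
          using y i by (auto simp: mem_box inner_add_left)
        moreover have "a \<bullet> i < x \<bullet> i" using x(1) i by (auto simp: mem_box)
        ultimately show "a \<bullet> i \<le> y \<bullet> i" "y \<bullet> i \<le> c \<bullet> i" using h(1)[OF i] by linarith+
      qed
    qed
    have "integral (cbox x (x + h *\<^sub>R One)) F = integral (cbox x (x + h *\<^sub>R One)) w"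
      using sub by (intro integral_cong) (auto simp: F_def)
    also have "\<dots> = 0" by (rule zero[OF sub])
    finally have "\<bar>F x\<bar> < \<bar>w x\<bar>" using d(2)[OF h(2,3)] by simp
    moreover have "F x = w x" using x(1) box_subset_cbox by (auto simp: F_def)
    ultimately show False by simp
  qed
  then have "{x \<in> cbox a c. w x \<noteq> 0} \<subseteq> N \<union> (cbox a c - box a c)" by blast
  moreover have "negligible (N \<union> (cbox a c - box a c))"
    by (intro negligible_Un N negligible_frontier_interval)
  ultimately show ?thesis using negligible_subset by blast
qed

text \<open>An open set is a countable union of closed boxes contained in it, and countably many
  null sets have a null union.\<close>

lemma AE_eq_0_if_orthogonal_test_functions:
  fixes w :: "'a::euclidean_space \<Rightarrow> real"
  assumes "open \<Omega>" and lint: "locally_integrable_on w \<Omega>"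
    and orth: "\<And>\<phi>. \<phi> \<in> test_functions \<Omega> \<Longrightarrow> (\<integral>x. w x * \<phi> x \<partial>lebesgue_on \<Omega>) = 0"
  shows "AE x in lebesgue_on \<Omega>. w x = 0"
proof (rule AE_lebesgue_on_negligibleI)
  show "\<Omega> \<in> sets lebesgue" using \<open>open \<Omega>\<close> by simp
  obtain \<D> where \<D>: "countable \<D>" "\<D> \<subseteq> Pow \<Omega>" "\<And>X. X \<in> \<D> \<Longrightarrow> \<exists>a b. X = cbox a b" "\<Union>\<D> = \<Omega>"
    using open_countable_Union_open_cbox[OF \<open>open \<Omega>\<close>] by metis
  have "negligible {x \<in> X. w x \<noteq> 0}" if X: "X \<in> \<D>" for X
  proof -
    obtain a c where ac: "X = cbox a c" using \<D>(3)[OF X] by blast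
    have sub: "cbox a c \<subseteq> \<Omega>" using \<D>(2) X ac by blast
    then have "w absolutely_integrable_on cbox a c"
      using lint by (simp add: locally_integrable_on_def compact_cbox)
    then show ?thesis
      unfolding ac
    proof (rule negligible_if_integrals_cbox_eq_0)
      fix u v assume "cbox u v \<subseteq> cbox a c"
      with sub have "cbox u v \<subseteq> \<Omega>" by blast
      from integral_cbox_eq_0_if_orthogonal_test_functions[OF assms this]
      show "integral (cbox u v) w = 0" .
    qed
  qed
  then have "negligible (\<Union>X\<in>\<D>. {x \<in> X. w x \<noteq> 0})"
    using \<D>(1) by (intro negligible_countable_Union) auto
  moreover have "(\<Union>X\<in>\<D>. {x \<in> X. w x \<noteq> 0}) = {x \<in> \<Omega>. w x \<noteq> 0}"
    using \<D>(4) by blast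
  ultimately show "negligible {x \<in> \<Omega>. w x \<noteq> 0}" by simp
qed

section \<open>Square-integrable functions\<close>

lemma integrable_mult_of_squares:
  fixes u v :: "'a \<Rightarrow> real"
  assumes [measurable]: "u \<in> borel_measurable M" "v \<in> borel_measurable M"
    and "integrable M (\<lambda>x. (u x)\<^sup>2)" "integrable M (\<lambda>x. (v x)\<^sup>2)"
  shows "integrable M (\<lambda>x. u x * v x)"
proof (rule Bochner_Integration.integrable_bound)
  show "integrable M (\<lambda>x. (u x)\<^sup>2 + (v x)\<^sup>2)" using assms by simp
  have "\<bar>u x * v x\<bar> \<le> (u x)\<^sup>2 + (v x)\<^sup>2" for x
  proof -
    have "0 \<le> (\<bar>u x\<bar> - \<bar>v x\<bar>)\<^sup>2" by simp
    then have "2 * \<bar>u x * v x\<bar> \<le> (u x)\<^sup>2 + (v x)\<^sup>2"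
      by (simp add: power2_diff abs_mult)
    then show ?thesis by linarith
  qed
  then show "AE x in M. norm (u x * v x) \<le> norm ((u x)\<^sup>2 + (v x)\<^sup>2)"
    by (intro always_eventually allI) (simp add: abs_of_nonneg)
qed simp

text \<open>The discriminant criterion behind Cauchy-Schwarz, with C = 0 allowed because the forms
  concerned are only semidefinite on functions. With A = 0 it also turns minimality into the
  critical equation.\<close>

lemma square_le_mult_if_quadratic_nonneg:
  fixes A B C :: real
  assumes "\<And>t. 0 \<le> A + 2 * t * B + t\<^sup>2 * C" "0 \<le> C"
  shows "B\<^sup>2 \<le> A * C"
proof (cases "C = 0")
  case True
  have "B = 0"
  proof (rule ccontr)
    assume "B \<noteq> 0"
    \<comment> \<open>For C = 0 the expression is affine in t and takes the value -1 at this
      point.\<close>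
    then show False using assms(1)[of "- (A + 1) / (2 * B)"] True by (simp add: field_simps)
  qed
  then show ?thesis using True by simp
next
  case False
  then have "C > 0" using assms(2) by simp
  \<comment> \<open>-B/C is the vertex of the parabola.\<close>
  have "0 \<le> A + 2 * (- B / C) * B + (- B / C)\<^sup>2 * C" by (rule assms(1))
  also have "\<dots> = A - B\<^sup>2 / C" using \<open>C > 0\<close> by (simp add: power2_eq_square field_simps)
  finally show ?thesis using \<open>C > 0\<close> by (simp add: field_simps)
qed

text \<open>On a finite measure space fast convergence in mean square gives summable increments in
  \<open>L\<^sup>1\<close>, hence convergence almost everywhere; Fatou's lemma then identifies the limit.\<close>

lemma L2_fast_Cauchy_complete:
  fixes u :: "nat \<Rightarrow> 'a \<Rightarrow> real"
  assumes "finite_measure M"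
    and [measurable]: "\<And>k. u k \<in> borel_measurable M"
    and sq: "\<And>k. integrable M (\<lambda>x. (u k x)\<^sup>2)"
    and cauchy: "\<And>j k. k \<le> j \<Longrightarrow> (\<integral>x. (u j x - u k x)\<^sup>2 \<partial>M) \<le> C / 4 ^ k"
  shows "\<exists>v\<in>borel_measurable M. integrable M (\<lambda>x. (v x)\<^sup>2) \<and>
           (\<forall>k. (\<integral>x. (v x - u k x)\<^sup>2 \<partial>M) \<le> C / 4 ^ k)"
proof -
  interpret finite_measure M by fact
  have isq: "integrable M (\<lambda>x. (u j x - u k x)\<^sup>2)" for j k
    using integrable_mult_of_squares[OF _ _ sq sq] sq by (simp add: power2_diff mult.assoc)
  have C: "0 \<le> C"
    using order_trans[OF integral_nonneg_AE cauchy[of 0 0]] by simp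
  define d where "d k x = \<bar>u (Suc k) x - u k x\<bar>" for k x
  have [measurable]: "d k \<in> borel_measurable M" for k
    unfolding d_def[abs_def] by measurable
  have d1: "(\<integral>\<^sup>+x. ennreal (d k x) \<partial>M) \<le> ennreal ((C + measure M (space M)) * (1/2) ^ k)" for k
  proof -
    \<comment> \<open>Arithmetic-geometric mean with weight 2^k. The integral of the square is at
      most C / 4^k, so the first term contributes at most C / 2^k; the constant second term is
      integrable since the measure is finite. Both bounds are summable.\<close>
    have "d k x \<le> 2 ^ k * (u (Suc k) x - u k x)\<^sup>2 + (1/2) ^ k" for x
    proof -
      have "0 \<le> (2 ^ k * d k x - 1)\<^sup>2" by simp
      then have "2 * 2 ^ k * d k x \<le> (2 ^ k)\<^sup>2 * (d k x)\<^sup>2 + 1"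
        by (simp add: power2_diff power_mult_distrib mult.assoc)
      then have "2 * d k x \<le> 2 ^ k * (d k x)\<^sup>2 + (1/2) ^ k"
        by (simp add: field_simps power2_eq_square)
      moreover have "0 \<le> d k x" by (simp add: d_def)
      ultimately have "d k x \<le> 2 ^ k * (d k x)\<^sup>2 + (1/2) ^ k" by linarith
      then show ?thesis by (simp add: d_def)
    qed
    then have "(\<integral>\<^sup>+x. ennreal (d k x) \<partial>M) \<le> (\<integral>\<^sup>+x. ennreal (2 ^ k * (u (Suc k) x - u k x)\<^sup>2 + (1/2) ^ k) \<partial>M)"
      by (intro nn_integral_mono ennreal_leI)
    also have "\<dots> = ennreal (\<integral>x. 2 ^ k * (u (Suc k) x - u k x)\<^sup>2 + (1/2) ^ k \<partial>M)"
      using isq by (intro nn_integral_eq_integral) auto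
    also have "(\<integral>x. 2 ^ k * (u (Suc k) x - u k x)\<^sup>2 + (1/2) ^ k \<partial>M)
        = 2 ^ k * (\<integral>x. (u (Suc k) x - u k x)\<^sup>2 \<partial>M) + measure M (space M) * (1/2) ^ k"
      using isq by simp
    also have "\<dots> \<le> 2 ^ k * (C / 4 ^ k) + measure M (space M) * (1/2) ^ k"
      using cauchy[of k "Suc k"] by (intro add_right_mono mult_left_mono) auto
    also have "(2::real) ^ k * (C / 4 ^ k) = C * (1/2) ^ k"
    proof -
      have "(4::real) ^ k = 2 ^ k * 2 ^ k"
        using power_mult_distrib[of "2::real" 2 k] by simp
      then show ?thesis by (simp add: power_one_over)
    qed
    finally show ?thesis by (simp add: algebra_simps ennreal_leI)
  qed
  have "(\<integral>\<^sup>+x. (\<Sum>k. ennreal (d k x)) \<partial>M) = (\<Sum>k. \<integral>\<^sup>+x. ennreal (d k x) \<partial>M)"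
    by (rule nn_integral_suminf) measurable
  also have "\<dots> \<le> (\<Sum>k. ennreal ((C + measure M (space M)) * (1/2) ^ k))"
    by (intro suminf_le d1 summableI)
  also have "\<dots> = ennreal (\<Sum>k. (C + measure M (space M)) * (1/2) ^ k)"
    using C by (intro suminf_ennreal2 summable_mult summable_geometric) auto
  finally have "(\<integral>\<^sup>+x. (\<Sum>k. ennreal (d k x)) \<partial>M) < \<infinity>"
    by (rule le_less_trans) (simp add: ennreal_less_top)
  then have "AE x in M. (\<Sum>k. ennreal (d k x)) \<noteq> \<infinity>"
    by (intro nn_integral_PInf_AE) auto
  moreover have "convergent (\<lambda>k. u k x)" if "(\<Sum>k. ennreal (d k x)) \<noteq> \<infinity>" for x
  proof -
    have "summable (\<lambda>k. d k x)"
      using that by (intro summable_suminf_not_top) (auto simp: d_def)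
    then have "summable (\<lambda>k. u (Suc k) x - u k x)"
      unfolding d_def by (rule summable_rabs_cancel)
    then have "convergent (\<lambda>n. \<Sum>k<n. u (Suc k) x - u k x)"
      by (simp add: summable_iff_convergent)
    then have "convergent (\<lambda>n. u n x - u 0 x)"
      by (simp only: sum_lessThan_telescope[of "\<lambda>k. u k x"])
    from convergent_add[OF this convergent_const[of "u 0 x"]] show ?thesis by simp
  qed
  ultimately have conv: "AE x in M. (\<lambda>k. u k x) \<longlonglongrightarrow> lim (\<lambda>k. u k x)"
    by (auto simp: convergent_LIMSEQ_iff elim!: eventually_mono)
  \<comment> \<open>\<open>lim\<close> is total, which gives a measurable function on the whole
    space; its values at points of divergence matter only on a null set.\<close>
  define v where "v x = lim (\<lambda>k. u k x)" for x
  have [measurable]: "v \<in> borel_measurable M"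
    unfolding v_def[abs_def] by measurable
  have fatou: "(\<integral>\<^sup>+x. ennreal ((v x - u k x)\<^sup>2) \<partial>M) \<le> ennreal (C / 4 ^ k)" for k
  proof -
    have "(\<integral>\<^sup>+x. ennreal ((v x - u k x)\<^sup>2) \<partial>M) \<le> (\<integral>\<^sup>+x. liminf (\<lambda>j. ennreal ((u j x - u k x)\<^sup>2)) \<partial>M)"
    proof (rule nn_integral_mono_AE, use conv in eventually_elim)
      fix x assume "(\<lambda>j. u j x) \<longlonglongrightarrow> lim (\<lambda>j. u j x)"
      then have "(\<lambda>j. ennreal ((u j x - u k x)\<^sup>2)) \<longlonglongrightarrow> ennreal ((v x - u k x)\<^sup>2)"
        unfolding v_def by (intro tendsto_ennrealI tendsto_intros)
      then show "ennreal ((v x - u k x)\<^sup>2) \<le> liminf (\<lambda>j. ennreal ((u j x - u k x)\<^sup>2))"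
        by (simp only: lim_imp_Liminf[OF sequentially_bot] order_refl)
    qed
    also have "\<dots> \<le> liminf (\<lambda>j. \<integral>\<^sup>+x. ennreal ((u j x - u k x)\<^sup>2) \<partial>M)"
      by (rule nn_integral_liminf) measurable
    also have "\<dots> \<le> ennreal (C / 4 ^ k)"
    proof (rule Liminf_le)
      have "(\<integral>\<^sup>+x. ennreal ((u j x - u k x)\<^sup>2) \<partial>M) \<le> ennreal (C / 4 ^ k)" if "k \<le> j" for j
        using isq cauchy[OF that] by (subst nn_integral_eq_integral) (auto intro: ennreal_leI)
      then show "\<forall>\<^sub>F j in sequentially. (\<integral>\<^sup>+x. ennreal ((u j x - u k x)\<^sup>2) \<partial>M) \<le> ennreal (C / 4 ^ k)"
        using eventually_sequentially by blast
    qed simp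
    finally show ?thesis .
  qed
  have iv: "integrable M (\<lambda>x. (v x - u k x)\<^sup>2)" for k
    using fatou[of k] by (intro integrableI_bounded) (auto intro: le_less_trans)
  have "(\<integral>x. (v x - u k x)\<^sup>2 \<partial>M) \<le> C / 4 ^ k" for k
    using fatou[of k] C by (subst (asm) nn_integral_eq_integral[OF iv]) (auto simp: ennreal_le_iff)
  moreover have "integrable M (\<lambda>x. (v x)\<^sup>2)"
  proof -
    have "integrable M (\<lambda>x. (v x - u 0 x) * u 0 x)"
      by (rule integrable_mult_of_squares[OF _ _ iv sq]) measurable
    then have "integrable M (\<lambda>x. (v x - u 0 x)\<^sup>2 + 2 * ((v x - u 0 x) * u 0 x) + (u 0 x)\<^sup>2)"
      using iv sq by (intro Bochner_Integration.integrable_add integrable_mult_right)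
    moreover have "(v x - u 0 x)\<^sup>2 + 2 * ((v x - u 0 x) * u 0 x) + (u 0 x)\<^sup>2 = (v x)\<^sup>2" for x
      by (simp add: power2_eq_square algebra_simps)
    ultimately show ?thesis by simp
  qed
  ultimately show ?thesis by (intro bexI[of _ v]) auto
qed

text \<open>Translates the rate of squared norms into the rate of norms.\<close>

lemma half_power_squared: "((1/2 :: real) ^ k)\<^sup>2 = 1 / 4 ^ k"
proof -
  have "((1/2 :: real) ^ k)\<^sup>2 = ((1/2)\<^sup>2) ^ k"
    by (simp only: power_mult[symmetric] mult.commute)
  then show ?thesis by (simp add: power2_eq_square power_one_over)
qed

section \<open>The semi-inner product of square-integrable functions\<close>

lemma L2D:
  assumes "u \<in> L2 \<Omega>"
  shows "u \<in> borel_measurable (lebesgue_on \<Omega>)" "integrable (lebesgue_on \<Omega>) (\<lambda>x. (u x)\<^sup>2)"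
  using assms by (auto simp: L2_def)

lemma L2_mult_integrable:
  "u \<in> L2 \<Omega> \<Longrightarrow> v \<in> L2 \<Omega> \<Longrightarrow> integrable (lebesgue_on \<Omega>) (\<lambda>x. u x * v x)"
  by (intro integrable_mult_of_squares L2D)

text \<open>The combination \<open>u + c v\<close> is the common shape of all linearity statements
  here: c = 1 gives sums, c = -1 differences, and variable \<open>c\<close> the variation along a
  line.\<close>

lemma L2_add_cmult:
  assumes "u \<in> L2 \<Omega>" "v \<in> L2 \<Omega>"
  shows "(\<lambda>x. u x + c * v x) \<in> L2 \<Omega>"
proof -
  have "integrable (lebesgue_on \<Omega>) (\<lambda>x. (u x)\<^sup>2 + 2 * c * (u x * v x) + c\<^sup>2 * (v x)\<^sup>2)"
    using L2_mult_integrable[OF assms] assms[THEN L2D(2)]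
    by (intro Bochner_Integration.integrable_add integrable_mult_right)
  moreover have "(u x + c * v x)\<^sup>2 = (u x)\<^sup>2 + 2 * c * (u x * v x) + c\<^sup>2 * (v x)\<^sup>2" for x
    by (simp add: power2_eq_square algebra_simps)
  ultimately have "integrable (lebesgue_on \<Omega>) (\<lambda>x. (u x + c * v x)\<^sup>2)" by simp
  then show ?thesis
    using assms[THEN L2D(1)] by (simp add: L2_def)
qed

lemma L2_diff: "u \<in> L2 \<Omega> \<Longrightarrow> v \<in> L2 \<Omega> \<Longrightarrow> (\<lambda>x. u x - v x) \<in> L2 \<Omega>"
  using L2_add_cmult[of u \<Omega> v "-1"] by simp

lemma inner_L2_commute: "inner_L2 \<Omega> u v = inner_L2 \<Omega> v u"
  by (simp add: inner_L2_def mult.commute)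

lemma inner_L2_nonneg: "0 \<le> inner_L2 \<Omega> u u"
  by (simp add: inner_L2_def integral_nonneg_AE)

lemma inner_L2_add_cmult_left:
  assumes "u \<in> L2 \<Omega>" "v \<in> L2 \<Omega>" "w \<in> L2 \<Omega>"
  shows "inner_L2 \<Omega> (\<lambda>x. u x + c * v x) w = inner_L2 \<Omega> u w + c * inner_L2 \<Omega> v w"
proof -
  have "inner_L2 \<Omega> (\<lambda>x. u x + c * v x) w = (\<integral>x. u x * w x + c * (v x * w x) \<partial>lebesgue_on \<Omega>)"
    by (simp add: inner_L2_def algebra_simps)
  also have "\<dots> = inner_L2 \<Omega> u w + c * inner_L2 \<Omega> v w"
    using assms by (simp add: inner_L2_def L2_mult_integrable)
  finally show ?thesis .
qed

lemma inner_L2_diff_left: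
  assumes "u \<in> L2 \<Omega>" "v \<in> L2 \<Omega>" "w \<in> L2 \<Omega>"
  shows "inner_L2 \<Omega> (\<lambda>x. u x - v x) w = inner_L2 \<Omega> u w - inner_L2 \<Omega> v w"
  using inner_L2_add_cmult_left[OF assms, of "-1"] by simp

lemma inner_L2_square_add_cmult:
  assumes "u \<in> L2 \<Omega>" "v \<in> L2 \<Omega>"
  shows "inner_L2 \<Omega> (\<lambda>x. u x + c * v x) (\<lambda>x. u x + c * v x) =
    inner_L2 \<Omega> u u + 2 * c * inner_L2 \<Omega> u v + c\<^sup>2 * inner_L2 \<Omega> v v"
proof -
  note l = inner_L2_add_cmult_left[OF assms]
  have "inner_L2 \<Omega> (\<lambda>x. u x + c * v x) (\<lambda>x. u x + c * v x) =
      inner_L2 \<Omega> (\<lambda>x. u x + c * v x) u + c * inner_L2 \<Omega> (\<lambda>x. u x + c * v x) v"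
    using l[OF L2_add_cmult[OF assms, of c], of c]
    by (simp add: inner_L2_commute[of \<Omega> u] inner_L2_commute[of \<Omega> v])
  then show ?thesis
    by (simp add: l[OF assms(1)] l[OF assms(2)] inner_L2_commute[of \<Omega> v u] power2_eq_square algebra_simps)
qed

lemma inner_L2_Cauchy_Schwarz:
  assumes "u \<in> L2 \<Omega>" "v \<in> L2 \<Omega>"
  shows "(inner_L2 \<Omega> u v)\<^sup>2 \<le> inner_L2 \<Omega> u u * inner_L2 \<Omega> v v"
proof (rule square_le_mult_if_quadratic_nonneg)
  show "0 \<le> inner_L2 \<Omega> u u + 2 * t * inner_L2 \<Omega> u v + t\<^sup>2 * inner_L2 \<Omega> v v" for t
    using inner_L2_nonneg[of \<Omega> "\<lambda>x. u x + t * v x"] by (simp add: inner_L2_square_add_cmult assms)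
qed (rule inner_L2_nonneg)

lemma inner_L2_cong_AE:
  assumes "u \<in> L2 \<Omega>" "v \<in> L2 \<Omega>" "u' \<in> L2 \<Omega>" "v' \<in> L2 \<Omega>"
    and "AE x in lebesgue_on \<Omega>. u x = u' x" "AE x in lebesgue_on \<Omega>. v x = v' x"
  shows "inner_L2 \<Omega> u v = inner_L2 \<Omega> u' v'"
  unfolding inner_L2_def using assms
  by (intro integral_cong_AE borel_measurable_times L2D) (auto elim: eventually_elim2)

text \<open>Rests on the completeness of Lebesgue measure. It is what allows a representative to be
  changed on a null set without leaving \<open>L2\<close>.\<close>

lemma AE_lebesgue_on_measurable:
  fixes u v :: "'a::euclidean_space \<Rightarrow> real"
  assumes S: "S \<in> sets lebesgue" and "u \<in> borel_measurable (lebesgue_on S)"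
    and ae: "AE x in lebesgue_on S. u x = v x"
  shows "v \<in> borel_measurable (lebesgue_on S)"
proof -
  have "(\<lambda>x. indicator S x *\<^sub>R u x) \<in> borel_measurable lebesgue"
    using assms by (simp add: borel_measurable_restrict_space_iff)
  moreover have "AE x in lebesgue. indicator S x *\<^sub>R u x = indicator S x *\<^sub>R v x"
    using ae S by (auto simp: AE_restrict_space_iff indicator_def elim!: eventually_mono)
  ultimately have "(\<lambda>x. indicator S x *\<^sub>R v x) \<in> borel_measurable lebesgue"
    by (rule borel_measurable_AE)
  then show ?thesis
    using S by (simp add: borel_measurable_restrict_space_iff)
qed

lemma L2_cong_AE:
  assumes "\<Omega> \<in> sets lebesgue" "u \<in> L2 \<Omega>" "AE x in lebesgue_on \<Omega>. u x = v x"
  shows "v \<in> L2 \<Omega>"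
proof -
  have m: "v \<in> borel_measurable (lebesgue_on \<Omega>)"
    using AE_lebesgue_on_measurable[OF assms(1) L2D(1)[OF assms(2)] assms(3)] .
  have "integrable (lebesgue_on \<Omega>) (\<lambda>x. (v x)\<^sup>2)"
    by (rule integrable_cong_AE_imp[OF L2D(2)[OF assms(2)]])
       (use m assms(3) in \<open>auto elim!: eventually_mono\<close>)
  with m show ?thesis by (simp add: L2_def)
qed

lemma L2_compact_support:
  fixes f :: "'a::euclidean_space \<Rightarrow> real"
  assumes "\<Omega> \<in> sets lebesgue" "continuous_on UNIV f" "compact K" "\<And>x. x \<notin> K \<Longrightarrow> f x = 0"
  shows "f \<in> L2 \<Omega>"
proof -
  have f: "f \<in> borel_measurable borel"
    using assms(2) by (rule borel_measurable_continuous_onI)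
  then have fl: "f \<in> borel_measurable lebesgue"
    by (intro measurable_completion) simp
  have "integrable lborel (\<lambda>x. (f x)\<^sup>2)"
    by (rule integrable_lborel_compact_support[OF _ assms(3)])
       (auto intro: continuous_on_power assms(2) simp: assms(4))
  then have "integrable lebesgue (\<lambda>x. (f x)\<^sup>2)"
    using f by (subst integrable_completion) auto
  then have "integrable lebesgue (\<lambda>x. indicator \<Omega> x *\<^sub>R (f x)\<^sup>2)"
    by (rule integrable_mult_indicator[OF assms(1)])
  then have "integrable (lebesgue_on \<Omega>) (\<lambda>x. (f x)\<^sup>2)"
    using assms(1) by (simp add: integrable_restrict_space)
  moreover have "f \<in> borel_measurable (lebesgue_on \<Omega>)"
    using fl by (rule measurable_restrict_space1)
  ultimately show ?thesis by (simp add: L2_def)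
qed

text \<open>The integral of a non-integrable function is 0 by convention, so the integrals in the
  definition of a weak derivative can be split only once this is known. Boundedness of the
  continuous factor on its support reduces the claim to local integrability of
  \<open>w\<close>.\<close>

lemma locally_integrable_on_mult_integrable:
  fixes f w :: "'a::euclidean_space \<Rightarrow> real"
  assumes "\<Omega> \<in> sets lebesgue" "locally_integrable_on w \<Omega>"
    and "continuous_on UNIV f" "compact K" "K \<subseteq> \<Omega>" "\<And>x. x \<notin> K \<Longrightarrow> f x = 0"
  shows "integrable (lebesgue_on \<Omega>) (\<lambda>x. w x * f x)"
proof -
  have f: "f \<in> borel_measurable lebesgue"
    using borel_measurable_continuous_onI[OF assms(3)] by (intro measurable_completion) simp
  have "bounded (f ` K)"
    by (intro compact_imp_bounded compact_continuous_image continuous_on_subset[OF assms(3)] assms) simp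
  then obtain B where B: "\<forall>y\<in>f ` K. norm y \<le> B"
    unfolding bounded_iff by blast
  define W where "W x = indicator K x *\<^sub>R w x" for x
  have W: "integrable lebesgue W"
    using assms(2,4,5) by (simp add: W_def[abs_def] locally_integrable_on_def set_integrable_def)
  have "integrable lebesgue (\<lambda>x. W x * f x)"
  proof (rule Bochner_Integration.integrable_bound)
    show "integrable lebesgue (\<lambda>x. B * W x)" using W by simp
    show "(\<lambda>x. W x * f x) \<in> borel_measurable lebesgue"
      by (intro borel_measurable_times borel_measurable_integrable[OF W] f)
    have "norm (W x * f x) \<le> norm (B * W x)" for x
    proof (cases "x \<in> K")
      case True
      then have "\<bar>f x\<bar> \<le> \<bar>B\<bar>" using B by force
      then show ?thesis by (simp add: abs_mult mult.commute[of "\<bar>W x\<bar>"] mult_right_mono)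
    qed (simp add: W_def)
    then show "AE x in lebesgue. norm (W x * f x) \<le> norm (B * W x)" by simp
  qed
  moreover have "(\<lambda>x. W x * f x) = (\<lambda>x. indicator \<Omega> x *\<^sub>R (w x * f x))"
  proof
    show "W x * f x = indicator \<Omega> x *\<^sub>R (w x * f x)" for x
      using assms(5) assms(6)[of x] by (cases "x \<in> K") (auto simp: W_def indicator_def)
  qed
  ultimately show ?thesis
    using assms(1) by (simp add: integrable_restrict_space)
qed

section \<open>Sobolev spaces on a bounded open set\<close>

locale bounded_open =
  fixes \<Omega> :: "'a::euclidean_space set"
  assumes bounded_set: "bounded \<Omega>" and open_set: "open \<Omega>"
begin

abbreviation "M \<equiv> lebesgue_on \<Omega>"
abbreviation "D \<equiv> weak_partial \<Omega>"

lemma sets_lebesgue: "\<Omega> \<in> sets lebesgue"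
  using open_set by simp

lemma finite_measure_lebesgue: "finite_measure M"
  using bounded_set open_set by (intro finite_measure_lebesgue_on lmeasurable_open)

lemma L2_locally_integrable_on:
  assumes "u \<in> L2 \<Omega>"
  shows "locally_integrable_on u \<Omega>"
proof -
  interpret finite_measure M by (rule finite_measure_lebesgue)
  \<comment> \<open>The constant 1 is square-integrable because the measure of
    \<open>\<Omega>\<close> is finite.\<close>
  have "integrable M (\<lambda>x. u x * 1)"
    by (rule integrable_mult_of_squares) (use L2D[OF assms] in auto)
  then have "set_integrable lebesgue \<Omega> u"
    using sets_lebesgue by (simp add: integrable_restrict_space set_integrable_def)
  then show ?thesis
    by (auto simp: locally_integrable_on_def intro: set_integrable_subset lmeasurable_compact fmeasurableD)
qed

lemma test_mult_integrable:
  assumes "locally_integrable_on w \<Omega>" "\<phi> \<in> test_functions \<Omega>"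
  shows "integrable M (\<lambda>x. w x * \<phi> x)"
    "b \<in> Basis \<Longrightarrow> integrable M (\<lambda>x. w x * partial_deriv b \<phi> x)"
proof -
  note t = test_functionsD[OF assms(2)]
  show "integrable M (\<lambda>x. w x * \<phi> x)"
    by (rule locally_integrable_on_mult_integrable[OF sets_lebesgue assms(1) t(3,5,6,7)])
  show "integrable M (\<lambda>x. w x * partial_deriv b \<phi> x)" if "b \<in> Basis"
    by (rule locally_integrable_on_mult_integrable[OF sets_lebesgue assms(1) t(4)[OF that] t(5,6)
          partial_deriv_outside_support])
qed

lemma test_L2:
  assumes "\<phi> \<in> test_functions \<Omega>"
  shows "\<phi> \<in> L2 \<Omega>" "b \<in> Basis \<Longrightarrow> partial_deriv b \<phi> \<in> L2 \<Omega>"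
proof -
  note t = test_functionsD[OF assms]
  show "\<phi> \<in> L2 \<Omega>"
    by (rule L2_compact_support[OF sets_lebesgue t(3,5,7)])
  show "partial_deriv b \<phi> \<in> L2 \<Omega>" if "b \<in> Basis"
    by (rule L2_compact_support[OF sets_lebesgue t(4)[OF that] t(5) partial_deriv_outside_support])
qed

section \<open>Weak derivatives up to null sets\<close>

lemma locally_integrable_on_add_cmult:
  assumes "locally_integrable_on u \<Omega>" "locally_integrable_on v \<Omega>"
  shows "locally_integrable_on (\<lambda>x. u x + c * v x) \<Omega>"
  using assms unfolding locally_integrable_on_def
  by (auto intro!: set_integral_add set_integrable_mult_right)

lemma is_weak_partial_unique:
  assumes 1: "is_weak_partial \<Omega> b u v" and 2: "is_weak_partial \<Omega> b u w"
  shows "AE x in M. v x = w x"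
proof -
  have lv: "locally_integrable_on v \<Omega>" and lw: "locally_integrable_on w \<Omega>"
    using 1 2 by (auto simp: is_weak_partial_def)
  have "AE x in M. v x + (-1) * w x = 0"
  proof (rule AE_eq_0_if_orthogonal_test_functions[OF open_set locally_integrable_on_add_cmult[OF lv lw]])
    fix \<phi> assume \<phi>: "\<phi> \<in> test_functions \<Omega>"
    have "(\<integral>x. (v x + (-1) * w x) * \<phi> x \<partial>M) = (\<integral>x. v x * \<phi> x - w x * \<phi> x \<partial>M)"
      by (simp add: algebra_simps)
    also have "\<dots> = (\<integral>x. v x * \<phi> x \<partial>M) - (\<integral>x. w x * \<phi> x \<partial>M)"
      by (intro Bochner_Integration.integral_diff test_mult_integrable(1) lv lw \<phi>)
    also have "\<dots> = 0"
      using 1 2 \<phi> by (auto simp: is_weak_partial_def)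
    finally show "(\<integral>x. (v x + (-1) * w x) * \<phi> x \<partial>M) = 0" .
  qed
  then show ?thesis by (auto elim!: eventually_mono)
qed

text \<open>\<open>SOME\<close> chooses among all weak derivatives, whether in \<open>L2\<close> or
  not; uniqueness ties the choice to any explicit one and brings square-integrability along. Later
  identities for \<open>D b\<close> are obtained by exhibiting a weak derivative and citing
  this.\<close>

lemma weak_partial_AE:
  assumes "is_weak_partial \<Omega> b u v"
  shows "is_weak_partial \<Omega> b u (D b u)" "AE x in M. v x = D b u x"
    "v \<in> L2 \<Omega> \<Longrightarrow> D b u \<in> L2 \<Omega>"
proof -
  show w: "is_weak_partial \<Omega> b u (D b u)"
    unfolding weak_partial_def by (rule someI[of "is_weak_partial \<Omega> b u", OF assms])
  show ae: "AE x in M. v x = D b u x"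
    by (rule is_weak_partial_unique[OF assms w])
  show "v \<in> L2 \<Omega> \<Longrightarrow> D b u \<in> L2 \<Omega>"
    by (rule L2_cong_AE[OF sets_lebesgue _ ae])
qed

lemma W12D:
  assumes "u \<in> W12 \<Omega>"
  shows "u \<in> L2 \<Omega>" "b \<in> Basis \<Longrightarrow> is_weak_partial \<Omega> b u (D b u)" "b \<in> Basis \<Longrightarrow> D b u \<in> L2 \<Omega>"
  using assms weak_partial_AE by (auto simp: W12_def)

lemma W12I:
  assumes "u \<in> L2 \<Omega>" "\<And>b. b \<in> Basis \<Longrightarrow> v b \<in> L2 \<Omega>"
    "\<And>b. b \<in> Basis \<Longrightarrow> is_weak_partial \<Omega> b u (v b)"
  shows "u \<in> W12 \<Omega>"
  using assms by (auto simp: W12_def)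

lemma is_weak_partial_add_cmult:
  assumes 1: "is_weak_partial \<Omega> b u v" and 2: "is_weak_partial \<Omega> b u' v'" and b: "b \<in> Basis"
  shows "is_weak_partial \<Omega> b (\<lambda>x. u x + c * u' x) (\<lambda>x. v x + c * v' x)"
proof -
  have l: "locally_integrable_on u \<Omega>" "locally_integrable_on v \<Omega>"
      "locally_integrable_on u' \<Omega>" "locally_integrable_on v' \<Omega>"
    using 1 2 by (auto simp: is_weak_partial_def)
  show ?thesis
    unfolding is_weak_partial_def
  proof (intro conjI ballI locally_integrable_on_add_cmult l)
    fix \<phi> assume \<phi>: "\<phi> \<in> test_functions \<Omega>"
    have "(\<integral>x. (u x + c * u' x) * partial_deriv b \<phi> x \<partial>M) =
        (\<integral>x. u x * partial_deriv b \<phi> x + c * (u' x * partial_deriv b \<phi> x) \<partial>M)"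
      by (simp add: algebra_simps)
    also have "\<dots> = (\<integral>x. u x * partial_deriv b \<phi> x \<partial>M) + c * (\<integral>x. u' x * partial_deriv b \<phi> x \<partial>M)"
      using test_mult_integrable(2)[OF _ \<phi> b] l by simp
    also have "\<dots> = - ((\<integral>x. v x * \<phi> x \<partial>M) + c * (\<integral>x. v' x * \<phi> x \<partial>M))"
      using 1 2 \<phi> by (simp add: is_weak_partial_def)
    also have "(\<integral>x. v x * \<phi> x \<partial>M) + c * (\<integral>x. v' x * \<phi> x \<partial>M) = (\<integral>x. v x * \<phi> x + c * (v' x * \<phi> x) \<partial>M)"
      using test_mult_integrable(1)[OF _ \<phi>] l by simp
    also have "\<dots> = (\<integral>x. (v x + c * v' x) * \<phi> x \<partial>M)"
      by (simp add: algebra_simps)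
    finally show "(\<integral>x. (u x + c * u' x) * partial_deriv b \<phi> x \<partial>M) = - (\<integral>x. (v x + c * v' x) * \<phi> x \<partial>M)" .
  qed
qed

lemma W12_add_cmult:
  assumes "u \<in> W12 \<Omega>" "v \<in> W12 \<Omega>"
  shows "(\<lambda>x. u x + c * v x) \<in> W12 \<Omega>"
    "b \<in> Basis \<Longrightarrow> AE x in M. D b u x + c * D b v x = D b (\<lambda>x. u x + c * v x) x"
proof -
  have *: "is_weak_partial \<Omega> b (\<lambda>x. u x + c * v x) (\<lambda>x. D b u x + c * D b v x)" if "b \<in> Basis" for b
    using that assms by (intro is_weak_partial_add_cmult W12D)
  show "(\<lambda>x. u x + c * v x) \<in> W12 \<Omega>"
    by (rule W12I[OF _ _ *]) (intro L2_add_cmult W12D assms; assumption)+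
  show "b \<in> Basis \<Longrightarrow> AE x in M. D b u x + c * D b v x = D b (\<lambda>x. u x + c * v x) x"
    by (rule weak_partial_AE(2)[OF *])
qed

lemma W12_diff: "u \<in> W12 \<Omega> \<Longrightarrow> v \<in> W12 \<Omega> \<Longrightarrow> (\<lambda>x. u x - v x) \<in> W12 \<Omega>"
  using W12_add_cmult(1)[of u v "-1"] by simp

lemma weak_partial_diff:
  "u \<in> W12 \<Omega> \<Longrightarrow> v \<in> W12 \<Omega> \<Longrightarrow> b \<in> Basis \<Longrightarrow> AE x in M. D b u x - D b v x = D b (\<lambda>x. u x - v x) x"
  using W12_add_cmult(2)[of u v b "-1"] by simp

lemma is_weak_partial_cong_AE:
  assumes w: "is_weak_partial \<Omega> b u v" and u: "u \<in> L2 \<Omega>" and ae: "AE x in M. u x = u' x" and b: "b \<in> Basis"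
  shows "is_weak_partial \<Omega> b u' v"
proof -
  have u': "u' \<in> L2 \<Omega>" using L2_cong_AE[OF sets_lebesgue u ae] .
  have "(\<integral>x. u' x * partial_deriv b \<phi> x \<partial>M) = (\<integral>x. u x * partial_deriv b \<phi> x \<partial>M)"
    if "\<phi> \<in> test_functions \<Omega>" for \<phi>
    using inner_L2_cong_AE[OF u' test_L2(2)[OF that b] u test_L2(2)[OF that b]] ae
    by (auto simp: inner_L2_def eq_commute)
  then show ?thesis
    using w L2_locally_integrable_on[OF u'] by (simp add: is_weak_partial_def)
qed

lemma W12_cong_AE:
  assumes "u \<in> W12 \<Omega>" "AE x in M. u x = v x"
  shows "v \<in> W12 \<Omega>" "b \<in> Basis \<Longrightarrow> AE x in M. D b u x = D b v x"
proof -
  have *: "is_weak_partial \<Omega> b v (D b u)" if "b \<in> Basis" for b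
    using is_weak_partial_cong_AE[OF W12D(2)[OF assms(1) that] W12D(1)[OF assms(1)] assms(2) that] .
  show "v \<in> W12 \<Omega>"
    by (rule W12I[OF L2_cong_AE[OF sets_lebesgue W12D(1)[OF assms(1)] assms(2)] W12D(3)[OF assms(1)] *])
  show "b \<in> Basis \<Longrightarrow> AE x in M. D b u x = D b v x"
    by (rule weak_partial_AE(2)[OF *])
qed

text \<open>Classical derivatives are weak ones by integration by parts. This makes estimates for
  \<open>partial_deriv\<close> of test functions available for the gradient form.\<close>

lemma test_W12:
  assumes \<phi>: "\<phi> \<in> test_functions \<Omega>"
  shows "\<phi> \<in> W12 \<Omega>" "b \<in> Basis \<Longrightarrow> AE x in M. partial_deriv b \<phi> x = D b \<phi> x"
proof -
  have *: "is_weak_partial \<Omega> b \<phi> (partial_deriv b \<phi>)" if b: "b \<in> Basis" for b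
    unfolding is_weak_partial_def
  proof (intro conjI ballI L2_locally_integrable_on test_L2(1)[OF \<phi>] test_L2(2)[OF \<phi> b])
    fix \<psi> assume \<psi>: "\<psi> \<in> test_functions \<Omega>"
    note t1 = test_functionsD[OF \<phi>] and t2 = test_functionsD[OF \<psi>]
    have "(\<integral>x. \<phi> x * partial_deriv b \<psi> x \<partial>M) = (\<integral>x. \<phi> x * partial_deriv b \<psi> x \<partial>lborel)"
    proof (rule integral_lebesgue_on_eq_lborel[OF sets_lebesgue])
      show "(\<lambda>x. \<phi> x * partial_deriv b \<psi> x) \<in> borel_measurable borel"
        by (intro borel_measurable_continuous_onI continuous_on_mult t1(3) t2(4) b)
      show "\<phi> x * partial_deriv b \<psi> x = 0" if "x \<notin> \<Omega>" for x
        using t1(7)[of x] t1(6) that by auto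
    qed
    also have "\<dots> = - (\<integral>x. partial_deriv b \<phi> x * \<psi> x \<partial>lborel)"
      by (rule integration_by_parts_test_functions[OF \<phi> \<psi> b])
    also have "(\<integral>x. partial_deriv b \<phi> x * \<psi> x \<partial>lborel) = (\<integral>x. partial_deriv b \<phi> x * \<psi> x \<partial>M)"
    proof (rule integral_lebesgue_on_eq_lborel[OF sets_lebesgue, symmetric])
      show "(\<lambda>x. partial_deriv b \<phi> x * \<psi> x) \<in> borel_measurable borel"
        by (intro borel_measurable_continuous_onI continuous_on_mult t1(4) t2(3) b)
      show "partial_deriv b \<phi> x * \<psi> x = 0" if "x \<notin> \<Omega>" for x
        using t2(7)[of x] t2(6) that by auto
    qed
    finally show "(\<integral>x. \<phi> x * partial_deriv b \<psi> x \<partial>M) = - (\<integral>x. partial_deriv b \<phi> x * \<psi> x \<partial>M)" .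
  qed
  show "\<phi> \<in> W12 \<Omega>"
    by (rule W12I[OF test_L2(1)[OF \<phi>] test_L2(2)[OF \<phi>] *])
  show "b \<in> Basis \<Longrightarrow> AE x in M. partial_deriv b \<phi> x = D b \<phi> x"
    by (rule weak_partial_AE(2)[OF *])
qed

section \<open>The gradient form as a semi-inner product\<close>

lemma inner_grad_eq_sum:
  assumes "u \<in> W12 \<Omega>" "v \<in> W12 \<Omega>"
  shows "inner_grad \<Omega> u v = (\<Sum>b\<in>Basis. inner_L2 \<Omega> (D b u) (D b v))"
  unfolding inner_grad_def inner_L2_def
  by (intro Bochner_Integration.integral_sum L2_mult_integrable W12D assms)

lemma inner_grad_commute: "inner_grad \<Omega> u v = inner_grad \<Omega> v u"
  by (simp add: inner_grad_def mult.commute)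

lemma inner_grad_nonneg: "0 \<le> inner_grad \<Omega> u u"
  unfolding inner_grad_def by (intro integral_nonneg_AE) (simp add: sum_nonneg)

lemma inner_grad_add_cmult_left:
  assumes "u \<in> W12 \<Omega>" "v \<in> W12 \<Omega>" "w \<in> W12 \<Omega>"
  shows "inner_grad \<Omega> (\<lambda>x. u x + c * v x) w = inner_grad \<Omega> u w + c * inner_grad \<Omega> v w"
proof -
  have "inner_L2 \<Omega> (D b (\<lambda>x. u x + c * v x)) (D b w) =
      inner_L2 \<Omega> (D b u) (D b w) + c * inner_L2 \<Omega> (D b v) (D b w)" if b: "b \<in> Basis" for b
  proof -
    have "inner_L2 \<Omega> (\<lambda>x. D b u x + c * D b v x) (D b w) = inner_L2 \<Omega> (D b (\<lambda>x. u x + c * v x)) (D b w)"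
      using W12_add_cmult(2)[OF assms(1,2) b]
      by (intro inner_L2_cong_AE L2_add_cmult W12D W12_add_cmult(1) assms b) auto
    then show ?thesis
      using inner_L2_add_cmult_left[OF assms[THEN W12D(3)[OF _ b]]] by simp
  qed
  then show ?thesis
    using assms by (simp add: inner_grad_eq_sum W12_add_cmult(1) sum.distrib sum_distrib_left)
qed

lemma inner_grad_square_add_cmult:
  assumes "u \<in> W12 \<Omega>" "v \<in> W12 \<Omega>"
  shows "inner_grad \<Omega> (\<lambda>x. u x + c * v x) (\<lambda>x. u x + c * v x) =
    inner_grad \<Omega> u u + 2 * c * inner_grad \<Omega> u v + c\<^sup>2 * inner_grad \<Omega> v v"
proof -
  note l = inner_grad_add_cmult_left[OF assms]
  have "inner_grad \<Omega> (\<lambda>x. u x + c * v x) (\<lambda>x. u x + c * v x) =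
      inner_grad \<Omega> (\<lambda>x. u x + c * v x) u + c * inner_grad \<Omega> (\<lambda>x. u x + c * v x) v"
    using l[OF W12_add_cmult(1)[OF assms, of c], of c]
    by (simp add: inner_grad_commute[of u] inner_grad_commute[of v])
  then show ?thesis
    by (simp add: l[OF assms(1)] l[OF assms(2)] inner_grad_commute[of v u] power2_eq_square algebra_simps)
qed

lemma inner_grad_Cauchy_Schwarz:
  assumes "u \<in> W12 \<Omega>" "v \<in> W12 \<Omega>"
  shows "(inner_grad \<Omega> u v)\<^sup>2 \<le> inner_grad \<Omega> u u * inner_grad \<Omega> v v"
proof (rule square_le_mult_if_quadratic_nonneg)
  show "0 \<le> inner_grad \<Omega> u u + 2 * t * inner_grad \<Omega> u v + t\<^sup>2 * inner_grad \<Omega> v v" for t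
    using inner_grad_nonneg[of "\<lambda>x. u x + t * v x"] by (simp add: inner_grad_square_add_cmult assms)
qed (rule inner_grad_nonneg)

lemma inner_grad_cong_AE:
  assumes "u \<in> W12 \<Omega>" "v \<in> W12 \<Omega>" "AE x in M. u x = u' x"
  shows "inner_grad \<Omega> u v = inner_grad \<Omega> u' v"
proof -
  have "inner_L2 \<Omega> (D b u) (D b v) = inner_L2 \<Omega> (D b u') (D b v)" if "b \<in> Basis" for b
    using W12_cong_AE[OF assms(1,3)] that
    by (intro inner_L2_cong_AE W12D assms) auto
  then show ?thesis
    using W12_cong_AE(1)[OF assms(1,3)] assms by (simp add: inner_grad_eq_sum)
qed

lemma inner_L2_weak_partial_le_inner_grad:
  assumes "u \<in> W12 \<Omega>" "b \<in> Basis"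
  shows "inner_L2 \<Omega> (D b u) (D b u) \<le> inner_grad \<Omega> u u"
  using assms by (auto simp: inner_grad_eq_sum inner_L2_nonneg intro!: member_le_sum)

lemma inner_W12_nonneg: "0 \<le> inner_W12 \<Omega> u u"
  by (simp add: inner_W12_def inner_L2_nonneg inner_grad_nonneg)

text \<open>By the parallelogram identity the squares for \<open>c\<close> and \<open>-c\<close> add
  up to the right-hand side; the nonnegative one for \<open>-c\<close> is dropped.\<close>

lemma inner_W12_square_add_cmult_le:
  assumes "u \<in> W12 \<Omega>" "v \<in> W12 \<Omega>"
  shows "inner_W12 \<Omega> (\<lambda>x. u x + c * v x) (\<lambda>x. u x + c * v x) \<le>
    2 * inner_W12 \<Omega> u u + 2 * c\<^sup>2 * inner_W12 \<Omega> v v"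
proof -
  have "0 \<le> inner_W12 \<Omega> (\<lambda>x. u x + (-c) * v x) (\<lambda>x. u x + (-c) * v x)"
    by (rule inner_W12_nonneg)
  then show ?thesis
    unfolding inner_W12_def inner_grad_square_add_cmult[OF assms]
      inner_L2_square_add_cmult[OF assms[THEN W12D(1)]]
    by (simp add: algebra_simps)
qed

section \<open>Functions vanishing on the border form a closed subspace\<close>

lemma W12_0_iff:
  "u \<in> W12_0 \<Omega> \<longleftrightarrow> u \<in> W12 \<Omega> \<and>
    (\<forall>\<epsilon>>0. \<exists>\<phi>\<in>test_functions \<Omega>. inner_W12 \<Omega> (\<lambda>x. u x - \<phi> x) (\<lambda>x. u x - \<phi> x) < \<epsilon>)"
proof -
  \<comment> \<open>Since \<epsilon> ranges over all positive numbers, it may be replaced by its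
    square or square root; afterwards only squared norms occur.\<close>
  have 1: "norm_W12 \<Omega> v < sqrt \<epsilon> \<longleftrightarrow> inner_W12 \<Omega> v v < \<epsilon>" for v \<epsilon>
    by (simp add: norm_W12_def)
  have 2: "norm_W12 \<Omega> v < \<epsilon> \<longleftrightarrow> inner_W12 \<Omega> v v < \<epsilon>\<^sup>2" if "\<epsilon> > 0" for v \<epsilon>
    using 1[of v "\<epsilon>\<^sup>2"] that by simp
  show ?thesis
    unfolding W12_0_def
  proof (intro iffI; clarsimp)
    fix \<epsilon> :: real
    assume "\<forall>\<epsilon>>0. \<exists>\<phi>\<in>test_functions \<Omega>. norm_W12 \<Omega> (\<lambda>x. u x - \<phi> x) < \<epsilon>" "\<epsilon> > 0"
    then show "\<exists>\<phi>\<in>test_functions \<Omega>. inner_W12 \<Omega> (\<lambda>x. u x - \<phi> x) (\<lambda>x. u x - \<phi> x) < \<epsilon>"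
      using 1 by (metis real_sqrt_gt_zero)
  next
    fix \<epsilon> :: real
    assume "\<forall>\<epsilon>>0. \<exists>\<phi>\<in>test_functions \<Omega>. inner_W12 \<Omega> (\<lambda>x. u x - \<phi> x) (\<lambda>x. u x - \<phi> x) < \<epsilon>" "\<epsilon> > 0"
    then show "\<exists>\<phi>\<in>test_functions \<Omega>. norm_W12 \<Omega> (\<lambda>x. u x - \<phi> x) < \<epsilon>"
      using 2 by (metis zero_less_power)
  qed
qed

lemma W12_0_W12: "u \<in> W12_0 \<Omega> \<Longrightarrow> u \<in> W12 \<Omega>"
  by (simp add: W12_0_def)

lemma W12_0_closed:
  assumes u: "u \<in> W12 \<Omega>"
    and lim: "\<And>\<epsilon>. \<epsilon> > 0 \<Longrightarrow> \<exists>h\<in>W12_0 \<Omega>. inner_W12 \<Omega> (\<lambda>x. u x - h x) (\<lambda>x. u x - h x) < \<epsilon>"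
  shows "u \<in> W12_0 \<Omega>"
  unfolding W12_0_iff
proof (intro conjI allI impI u)
  fix \<epsilon> :: real assume "\<epsilon> > 0"
  then obtain h where h: "h \<in> W12_0 \<Omega>" "inner_W12 \<Omega> (\<lambda>x. u x - h x) (\<lambda>x. u x - h x) < \<epsilon> / 4"
    \<comment> \<open>Two squared errors, each doubled, have to stay below \<epsilon>.\<close>
    using lim[of "\<epsilon> / 4"] by auto
  then obtain \<phi> where \<phi>: "\<phi> \<in> test_functions \<Omega>" "inner_W12 \<Omega> (\<lambda>x. h x - \<phi> x) (\<lambda>x. h x - \<phi> x) < \<epsilon> / 4"
    using \<open>\<epsilon> > 0\<close> unfolding W12_0_iff by (meson divide_pos_pos zero_less_numeral)
  have "inner_W12 \<Omega> (\<lambda>x. (u x - h x) + 1 * (h x - \<phi> x)) (\<lambda>x. (u x - h x) + 1 * (h x - \<phi> x)) \<le>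
      2 * inner_W12 \<Omega> (\<lambda>x. u x - h x) (\<lambda>x. u x - h x) + 2 * 1\<^sup>2 * inner_W12 \<Omega> (\<lambda>x. h x - \<phi> x) (\<lambda>x. h x - \<phi> x)"
    by (intro inner_W12_square_add_cmult_le W12_diff u W12_0_W12 h test_W12 \<phi>)
  with h \<phi> have "inner_W12 \<Omega> (\<lambda>x. u x - \<phi> x) (\<lambda>x. u x - \<phi> x) < \<epsilon>"
    by simp
  with \<phi> show "\<exists>\<phi>\<in>test_functions \<Omega>. inner_W12 \<Omega> (\<lambda>x. u x - \<phi> x) (\<lambda>x. u x - \<phi> x) < \<epsilon>" by blast
qed

lemma W12_0_add_cmult:
  assumes u: "u \<in> W12_0 \<Omega>" and v: "v \<in> W12_0 \<Omega>"
  shows "(\<lambda>x. u x + c * v x) \<in> W12_0 \<Omega>"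
  unfolding W12_0_iff
proof (intro conjI allI impI W12_add_cmult(1) W12_0_W12 u v)
  fix \<epsilon> :: real assume "\<epsilon> > 0"
  \<comment> \<open>Makes the error bound 2 \<delta> + 2 c^2 \<delta> equal to \<epsilon> /
    2.\<close>
  define \<delta> where "\<delta> = \<epsilon> / (4 * (1 + c\<^sup>2))"
  have \<delta>: "\<delta> > 0" "2 * \<delta> + 2 * c\<^sup>2 * \<delta> < \<epsilon>"
  proof -
    have "1 + c\<^sup>2 > 0" by (simp add: add_pos_nonneg)
    then show "\<delta> > 0" using \<open>\<epsilon> > 0\<close> by (simp add: \<delta>_def)
    have "(4 * (1 + c\<^sup>2)) * \<delta> = \<epsilon>"
      unfolding \<delta>_def using \<open>1 + c\<^sup>2 > 0\<close> by (intro nonzero_mult_div_cancel_left[THEN trans[OF times_divide_eq_right]]) simp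
    then have "2 * \<delta> + 2 * c\<^sup>2 * \<delta> = \<epsilon> / 2" by (simp add: algebra_simps)
    then show "2 * \<delta> + 2 * c\<^sup>2 * \<delta> < \<epsilon>" using \<open>\<epsilon> > 0\<close> by simp
  qed
  obtain \<phi> where \<phi>: "\<phi> \<in> test_functions \<Omega>" "inner_W12 \<Omega> (\<lambda>x. u x - \<phi> x) (\<lambda>x. u x - \<phi> x) < \<delta>"
    using u \<delta>(1) unfolding W12_0_iff by blast
  obtain \<psi> where \<psi>: "\<psi> \<in> test_functions \<Omega>" "inner_W12 \<Omega> (\<lambda>x. v x - \<psi> x) (\<lambda>x. v x - \<psi> x) < \<delta>"
    using v \<delta>(1) unfolding W12_0_iff by blast
  have "inner_W12 \<Omega> (\<lambda>x. (u x - \<phi> x) + c * (v x - \<psi> x)) (\<lambda>x. (u x - \<phi> x) + c * (v x - \<psi> x)) \<le>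
      2 * inner_W12 \<Omega> (\<lambda>x. u x - \<phi> x) (\<lambda>x. u x - \<phi> x) + 2 * c\<^sup>2 * inner_W12 \<Omega> (\<lambda>x. v x - \<psi> x) (\<lambda>x. v x - \<psi> x)"
    by (intro inner_W12_square_add_cmult_le W12_diff W12_0_W12 u v test_W12 \<phi> \<psi>)
  also have "\<dots> \<le> 2 * \<delta> + 2 * c\<^sup>2 * \<delta>"
    using \<phi>(2) \<psi>(2) by (intro add_mono mult_left_mono) auto
  also have "\<dots> < \<epsilon>" by (rule \<delta>(2))
  also have "(\<lambda>x. (u x - \<phi> x) + c * (v x - \<psi> x)) = (\<lambda>x. u x + c * v x - (\<phi> x + c * \<psi> x))"
    by (simp add: algebra_simps)
  finally show "\<exists>\<phi>\<in>test_functions \<Omega>.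
      inner_W12 \<Omega> (\<lambda>x. u x + c * v x - \<phi> x) (\<lambda>x. u x + c * v x - \<phi> x) < \<epsilon>"
    by (intro bexI[of _ "\<lambda>x. \<phi> x + c * \<psi> x"] test_functions_add_cmult \<phi>(1) \<psi>(1))
qed

lemma W12_0_diff: "u \<in> W12_0 \<Omega> \<Longrightarrow> v \<in> W12_0 \<Omega> \<Longrightarrow> (\<lambda>x. u x - v x) \<in> W12_0 \<Omega>"
  using W12_0_add_cmult[of u v "-1"] by simp

text \<open>The difference of the two representatives has seminorm 0, so \<open>u\<close> itself
  approximates \<open>v\<close> to every precision and closedness applies.\<close>

lemma W12_0_cong_AE:
  assumes u: "u \<in> W12_0 \<Omega>" and ae: "AE x in M. u x = v x"
  shows "v \<in> W12_0 \<Omega>"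
proof (rule W12_0_closed)
  have uW: "u \<in> W12 \<Omega>" using u by (rule W12_0_W12)
  show vW: "v \<in> W12 \<Omega>" using W12_cong_AE(1)[OF uW ae] .
  have ae': "AE x in M. u x - u x = v x - u x"
    using ae by (auto elim!: eventually_mono)
  have "inner_grad \<Omega> (\<lambda>x. v x - u x) (\<lambda>x. v x - u x) = inner_grad \<Omega> (\<lambda>x. u x - u x) (\<lambda>x. v x - u x)"
    by (rule inner_grad_cong_AE[OF W12_diff[OF uW uW] W12_diff[OF vW uW] ae', symmetric])
  also have "\<dots> = 0"
    using inner_grad_add_cmult_left[OF uW uW W12_diff[OF vW uW], of "-1"] by simp
  finally have "inner_grad \<Omega> (\<lambda>x. v x - u x) (\<lambda>x. v x - u x) = 0" .
  moreover have "inner_L2 \<Omega> (\<lambda>x. v x - u x) (\<lambda>x. v x - u x) = inner_L2 \<Omega> (\<lambda>x. u x - u x) (\<lambda>x. u x - u x)"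
    by (rule inner_L2_cong_AE[symmetric]; (intro L2_diff W12D uW vW ae'))
  then have "inner_L2 \<Omega> (\<lambda>x. v x - u x) (\<lambda>x. v x - u x) = 0"
    by (simp add: inner_L2_def)
  ultimately have "inner_W12 \<Omega> (\<lambda>x. v x - u x) (\<lambda>x. v x - u x) = 0"
    by (simp add: inner_W12_def)
  then show "\<exists>h\<in>W12_0 \<Omega>. inner_W12 \<Omega> (\<lambda>x. v x - h x) (\<lambda>x. v x - h x) < \<epsilon>" if "\<epsilon> > 0" for \<epsilon>
    using that u by (intro bexI[of _ u]) auto
qed

section \<open>The Poincare inequality\<close>

lemma Poincare_test_functions_inner:
  "\<exists>C\<ge>0. \<forall>\<phi>\<in>test_functions \<Omega>. inner_L2 \<Omega> \<phi> \<phi> \<le> C * inner_grad \<Omega> \<phi> \<phi>"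
proof -
  \<comment> \<open>One direction is enough: its derivative gives one of the nonnegative summands of
    the gradient form.\<close>
  obtain b :: 'a where b: "b \<in> Basis" using nonempty_Basis by blast
  obtain R where R: "\<And>x. x \<in> \<Omega> \<Longrightarrow> norm x \<le> R"
    using bounded_set unfolding bounded_iff by blast
  have "inner_L2 \<Omega> \<phi> \<phi> \<le> 4 * R\<^sup>2 * inner_grad \<Omega> \<phi> \<phi>" if \<phi>: "\<phi> \<in> test_functions \<Omega>" for \<phi>
  proof -
    note t = test_functionsD[OF \<phi>]
    have "inner_L2 \<Omega> \<phi> \<phi> = (\<integral>x. (\<phi> x)\<^sup>2 \<partial>lborel)"
      unfolding inner_L2_def power2_eq_square
    proof (rule integral_lebesgue_on_eq_lborel[OF sets_lebesgue])
      show "(\<lambda>x. \<phi> x * \<phi> x) \<in> borel_measurable borel"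
        by (intro borel_measurable_continuous_onI continuous_on_mult t(3))
      show "\<phi> x * \<phi> x = 0" if "x \<notin> \<Omega>" for x
        using t(7)[of x] t(6) that by auto
    qed
    also have "\<dots> \<le> 4 * R\<^sup>2 * (\<integral>x. (partial_deriv b \<phi> x)\<^sup>2 \<partial>lborel)"
      by (rule Poincare_test_functions[OF \<phi> b]) (meson Basis_le_norm R b order_trans)
    also have "(\<integral>x. (partial_deriv b \<phi> x)\<^sup>2 \<partial>lborel) = inner_L2 \<Omega> (partial_deriv b \<phi>) (partial_deriv b \<phi>)"
      unfolding inner_L2_def power2_eq_square
    proof (rule integral_lebesgue_on_eq_lborel[OF sets_lebesgue, symmetric])
      show "(\<lambda>x. partial_deriv b \<phi> x * partial_deriv b \<phi> x) \<in> borel_measurable borel"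
        by (intro borel_measurable_continuous_onI continuous_on_mult t(4) b)
      show "partial_deriv b \<phi> x * partial_deriv b \<phi> x = 0" if "x \<notin> \<Omega>" for x
        using partial_deriv_outside_support[of x \<phi> b] t(6) that by auto
    qed
    also have "\<dots> = inner_L2 \<Omega> (D b \<phi>) (D b \<phi>)"
      by (intro inner_L2_cong_AE test_L2 W12D test_W12 \<phi> b)
    also have "4 * R\<^sup>2 * \<dots> \<le> 4 * R\<^sup>2 * inner_grad \<Omega> \<phi> \<phi>"
      by (intro mult_left_mono inner_L2_weak_partial_le_inner_grad test_W12 \<phi> b) simp
    finally show ?thesis .
  qed
  then show ?thesis by (intro exI[of _ "4 * R\<^sup>2"]) auto
qed

text \<open>Both sides are compared with their values at an approximating test function. Each
  comparison loses a factor 2, so the constant becomes \<open>4 * K\<close> instead of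
  \<open>K\<close>, which is harmless because only the existence of a constant is claimed.\<close>

lemma Poincare_W12_0:
  "\<exists>C\<ge>0. \<forall>u\<in>W12_0 \<Omega>. inner_L2 \<Omega> u u \<le> C * inner_grad \<Omega> u u"
proof -
  obtain K where K: "K \<ge> 0" "\<And>\<phi>. \<phi> \<in> test_functions \<Omega> \<Longrightarrow> inner_L2 \<Omega> \<phi> \<phi> \<le> K * inner_grad \<Omega> \<phi> \<phi>"
    using Poincare_test_functions_inner by blast
  have "inner_L2 \<Omega> u u \<le> 4 * K * inner_grad \<Omega> u u" if u: "u \<in> W12_0 \<Omega>" for u
  proof (rule field_le_epsilon)
    fix \<epsilon> :: real assume "\<epsilon> > 0"
    \<comment> \<open>The errors total 2 \<delta> from \<open>inner_L2 \<Omega> r r\<close> and 4 K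
      \<delta> from \<open>inner_grad \<Omega> r r\<close>.\<close>
    define \<delta> where "\<delta> = \<epsilon> / (2 + 4 * K)"
    have \<delta>: "\<delta> > 0" "2 * \<delta> + 4 * K * \<delta> = \<epsilon>"
    proof -
      have "2 + 4 * K > 0" using K(1) by simp
      then show "\<delta> > 0" using \<open>\<epsilon> > 0\<close> by (simp add: \<delta>_def)
      have "(2 + 4 * K) * \<delta> = \<epsilon>" using \<open>2 + 4 * K > 0\<close> by (simp add: \<delta>_def)
      then show "2 * \<delta> + 4 * K * \<delta> = \<epsilon>" by (simp add: algebra_simps)
    qed
    obtain \<phi> where \<phi>: "\<phi> \<in> test_functions \<Omega>" "inner_W12 \<Omega> (\<lambda>x. u x - \<phi> x) (\<lambda>x. u x - \<phi> x) < \<delta>"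
      using u \<delta>(1) unfolding W12_0_iff by blast
    define r where "r x = u x - \<phi> x" for x
    have uW: "u \<in> W12 \<Omega>" and pW: "\<phi> \<in> W12 \<Omega>"
      using u \<phi> by (auto intro: W12_0_W12 test_W12)
    have rW: "r \<in> W12 \<Omega>"
      unfolding r_def[abs_def] by (rule W12_diff[OF uW pW])
    have r: "inner_L2 \<Omega> r r \<le> \<delta>" "inner_grad \<Omega> r r \<le> \<delta>"
      using \<phi>(2) inner_L2_nonneg[of \<Omega> r] inner_grad_nonneg[of r]
      by (auto simp: inner_W12_def r_def[abs_def])
    have 1: "inner_L2 \<Omega> u u \<le> 2 * inner_L2 \<Omega> r r + 2 * inner_L2 \<Omega> \<phi> \<phi>"
    proof -
      have "(\<lambda>x. r x + 1 * \<phi> x) = u" by (auto simp: r_def)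
      moreover note inner_L2_nonneg[of \<Omega> "\<lambda>x. r x + (-1) * \<phi> x"]
      ultimately show ?thesis
        using inner_L2_square_add_cmult[OF W12D(1)[OF rW] W12D(1)[OF pW], of 1]
          inner_L2_square_add_cmult[OF W12D(1)[OF rW] W12D(1)[OF pW], of "-1"] by simp
    qed
    have 2: "inner_grad \<Omega> \<phi> \<phi> \<le> 2 * inner_grad \<Omega> u u + 2 * inner_grad \<Omega> r r"
    proof -
      have "(\<lambda>x. u x + (-1) * r x) = \<phi>" by (auto simp: r_def)
      moreover note inner_grad_nonneg[of "\<lambda>x. u x + 1 * r x"]
      ultimately show ?thesis
        using inner_grad_square_add_cmult[OF uW rW, of 1] inner_grad_square_add_cmult[OF uW rW, of "-1"] by simp
    qed
    have "inner_L2 \<Omega> u u \<le> 2 * inner_L2 \<Omega> r r + 2 * (K * inner_grad \<Omega> \<phi> \<phi>)"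
      using 1 K(2)[OF \<phi>(1)] by linarith
    also have "K * inner_grad \<Omega> \<phi> \<phi> \<le> K * (2 * inner_grad \<Omega> u u + 2 * inner_grad \<Omega> r r)"
      by (rule mult_left_mono[OF 2 K(1)])
    also have "\<dots> \<le> K * (2 * inner_grad \<Omega> u u + 2 * \<delta>)"
      using r(2) K(1) by (intro mult_left_mono) auto
    finally have "inner_L2 \<Omega> u u \<le> 2 * \<delta> + 2 * (K * (2 * inner_grad \<Omega> u u + 2 * \<delta>))"
      using r(1) by linarith
    also have "\<dots> = 4 * K * inner_grad \<Omega> u u + (2 * \<delta> + 4 * K * \<delta>)" by (simp add: algebra_simps)
    finally show "inner_L2 \<Omega> u u \<le> 4 * K * inner_grad \<Omega> u u + \<epsilon>" by (simp add: \<delta>(2))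
  qed
  then show ?thesis using K(1) by (intro exI[of _ "4 * K"]) auto
qed

section \<open>Completeness\<close>

lemma tendsto_inner_L2:
  assumes w: "\<And>k. w k \<in> L2 \<Omega>" and v: "v \<in> L2 \<Omega>" and f: "f \<in> L2 \<Omega>"
    and le: "\<And>k. inner_L2 \<Omega> (\<lambda>x. v x - w k x) (\<lambda>x. v x - w k x) \<le> C / 4 ^ k"
  shows "(\<lambda>k. inner_L2 \<Omega> (w k) f) \<longlonglongrightarrow> inner_L2 \<Omega> v f"
proof -
  have C: "0 \<le> C"
    using order_trans[OF inner_L2_nonneg le[of 0]] by simp
  have "\<bar>inner_L2 \<Omega> (w k) f - inner_L2 \<Omega> v f\<bar> \<le> sqrt (C * inner_L2 \<Omega> f f) * (1/2) ^ k" for k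
  proof -
    have "(inner_L2 \<Omega> v f - inner_L2 \<Omega> (w k) f)\<^sup>2 \<le> C / 4 ^ k * inner_L2 \<Omega> f f"
      using inner_L2_Cauchy_Schwarz[OF L2_diff[OF v w[of k]] f] mult_right_mono[OF le[of k] inner_L2_nonneg[of \<Omega> f]]
      by (simp add: inner_L2_diff_left v w f)
    also have "\<dots> = (sqrt (C * inner_L2 \<Omega> f f) * (1/2) ^ k)\<^sup>2"
      using C inner_L2_nonneg[of \<Omega> f] by (simp add: power_mult_distrib half_power_squared)
    finally have "\<bar>inner_L2 \<Omega> v f - inner_L2 \<Omega> (w k) f\<bar> \<le> sqrt (C * inner_L2 \<Omega> f f) * (1/2) ^ k"
      using C inner_L2_nonneg[of \<Omega> f] by (intro power2_le_iff_abs_le[THEN iffD1]) auto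
    then show ?thesis by linarith
  qed
  then have "\<forall>\<^sub>F k in sequentially. norm (inner_L2 \<Omega> (w k) f - inner_L2 \<Omega> v f)
      \<le> sqrt (C * inner_L2 \<Omega> f f) * (1/2) ^ k"
    by simp
  moreover have "(\<lambda>k. sqrt (C * inner_L2 \<Omega> f f) * (1/2) ^ k) \<longlonglongrightarrow> 0"
    by (intro tendsto_mult_right_zero LIMSEQ_power_zero) simp
  ultimately have "(\<lambda>k. inner_L2 \<Omega> (w k) f - inner_L2 \<Omega> v f) \<longlonglongrightarrow> 0"
    by (rule Lim_null_comparison)
  then show ?thesis by (rule LIM_zero_cancel)
qed

lemma L2_complete:
  assumes w: "\<And>k. w k \<in> L2 \<Omega>"
    and cauchy: "\<And>j k. k \<le> j \<Longrightarrow> inner_L2 \<Omega> (\<lambda>x. w j x - w k x) (\<lambda>x. w j x - w k x) \<le> C / 4 ^ k"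
  shows "\<exists>v\<in>L2 \<Omega>. \<forall>k. inner_L2 \<Omega> (\<lambda>x. v x - w k x) (\<lambda>x. v x - w k x) \<le> C / 4 ^ k"
proof -
  have "\<exists>v\<in>borel_measurable M. integrable M (\<lambda>x. (v x)\<^sup>2) \<and>
      (\<forall>k. (\<integral>x. (v x - w k x)\<^sup>2 \<partial>M) \<le> C / 4 ^ k)"
    using cauchy w[THEN L2D(1)] w[THEN L2D(2)]
    by (intro L2_fast_Cauchy_complete finite_measure_lebesgue) (auto simp: inner_L2_def power2_eq_square)
  then show ?thesis
    by (auto simp: L2_def inner_L2_def power2_eq_square)
qed

text \<open>The functions and each of their weak derivatives converge separately in
  \<open>L2\<close>. Both sides of the defining identity are \<open>L2\<close> products with a fixed
  test function or its derivative, so the identity survives the limit and makes the limits of the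
  derivatives weak derivatives of the limit. The factor counts one error for the function and one
  for each direction.\<close>

lemma W12_complete:
  assumes w: "\<And>k. w k \<in> W12 \<Omega>"
    and cauchy: "\<And>j k. k \<le> j \<Longrightarrow> inner_W12 \<Omega> (\<lambda>x. w j x - w k x) (\<lambda>x. w j x - w k x) \<le> C / 4 ^ k"
  shows "\<exists>u\<in>W12 \<Omega>. \<forall>k. inner_W12 \<Omega> (\<lambda>x. u x - w k x) (\<lambda>x. u x - w k x) \<le> (1 + real DIM('a)) * C / 4 ^ k"
proof -
  have cL: "inner_L2 \<Omega> (\<lambda>x. w j x - w k x) (\<lambda>x. w j x - w k x) \<le> C / 4 ^ k" if "k \<le> j" for j k
    using cauchy[OF that] inner_grad_nonneg[of "\<lambda>x. w j x - w k x"] by (simp add: inner_W12_def)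
  obtain u where u: "u \<in> L2 \<Omega>" "\<And>k. inner_L2 \<Omega> (\<lambda>x. u x - w k x) (\<lambda>x. u x - w k x) \<le> C / 4 ^ k"
    using L2_complete[OF W12D(1)[OF w] cL] by blast
  have "\<exists>v\<in>L2 \<Omega>. \<forall>k. inner_L2 \<Omega> (\<lambda>x. v x - D b (w k) x) (\<lambda>x. v x - D b (w k) x) \<le> C / 4 ^ k"
    if b: "b \<in> Basis" for b
  proof (rule L2_complete[OF W12D(3)[OF w b]])
    fix j k :: nat assume "k \<le> j"
    note d = W12_diff[OF w[of j] w[of k]]
    have "inner_L2 \<Omega> (\<lambda>x. D b (w j) x - D b (w k) x) (\<lambda>x. D b (w j) x - D b (w k) x)
        = inner_L2 \<Omega> (D b (\<lambda>x. w j x - w k x)) (D b (\<lambda>x. w j x - w k x))"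
      by (intro inner_L2_cong_AE L2_diff W12D w d b weak_partial_diff)
    also have "\<dots> \<le> inner_grad \<Omega> (\<lambda>x. w j x - w k x) (\<lambda>x. w j x - w k x)"
      by (rule inner_L2_weak_partial_le_inner_grad[OF d b])
    also have "\<dots> \<le> C / 4 ^ k"
      using cauchy[OF \<open>k \<le> j\<close>] inner_L2_nonneg[of \<Omega> "\<lambda>x. w j x - w k x"] by (simp add: inner_W12_def)
    finally show "inner_L2 \<Omega> (\<lambda>x. D b (w j) x - D b (w k) x) (\<lambda>x. D b (w j) x - D b (w k) x) \<le> C / 4 ^ k" .
  qed
  then obtain v where v: "\<And>b. b \<in> Basis \<Longrightarrow> v b \<in> L2 \<Omega>"
      "\<And>b k. b \<in> Basis \<Longrightarrow> inner_L2 \<Omega> (\<lambda>x. v b x - D b (w k) x) (\<lambda>x. v b x - D b (w k) x) \<le> C / 4 ^ k"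
    by metis
  have wp: "is_weak_partial \<Omega> b u (v b)" if b: "b \<in> Basis" for b
    unfolding is_weak_partial_def
  proof (intro conjI ballI L2_locally_integrable_on u(1) v(1) b)
    fix \<phi> assume \<phi>: "\<phi> \<in> test_functions \<Omega>"
    have "(\<lambda>k. inner_L2 \<Omega> (w k) (partial_deriv b \<phi>)) \<longlonglongrightarrow> inner_L2 \<Omega> u (partial_deriv b \<phi>)"
      by (rule tendsto_inner_L2[OF W12D(1)[OF w] u(1) test_L2(2)[OF \<phi> b] u(2)])
    moreover have "inner_L2 \<Omega> (w k) (partial_deriv b \<phi>) = - inner_L2 \<Omega> (D b (w k)) \<phi>" for k
      using W12D(2)[OF w b, of k] \<phi> by (simp add: is_weak_partial_def inner_L2_def)
    moreover have "(\<lambda>k. - inner_L2 \<Omega> (D b (w k)) \<phi>) \<longlonglongrightarrow> - inner_L2 \<Omega> (v b) \<phi>"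
      by (intro tendsto_minus tendsto_inner_L2[OF W12D(3)[OF w b] v(1)[OF b] test_L2(1)[OF \<phi>] v(2)[OF b]])
    ultimately have "inner_L2 \<Omega> u (partial_deriv b \<phi>) = - inner_L2 \<Omega> (v b) \<phi>"
      using LIMSEQ_unique by auto
    then show "(\<integral>x. u x * partial_deriv b \<phi> x \<partial>M) = - (\<integral>x. v b x * \<phi> x \<partial>M)"
      by (simp add: inner_L2_def)
  qed
  have uW: "u \<in> W12 \<Omega>"
    by (rule W12I[OF u(1) v(1) wp])
  have "inner_W12 \<Omega> (\<lambda>x. u x - w k x) (\<lambda>x. u x - w k x) \<le> (1 + real DIM('a)) * C / 4 ^ k" for k
  proof -
    note d = W12_diff[OF uW w[of k]]
    have "inner_L2 \<Omega> (D b (\<lambda>x. u x - w k x)) (D b (\<lambda>x. u x - w k x)) \<le> C / 4 ^ k" if b: "b \<in> Basis" for b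
    proof -
      have "AE x in M. v b x - D b (w k) x = D b (\<lambda>x. u x - w k x) x"
        using weak_partial_AE(2)[OF wp[OF b]] weak_partial_diff[OF uW w[of k] b] by eventually_elim simp
      then have "inner_L2 \<Omega> (\<lambda>x. v b x - D b (w k) x) (\<lambda>x. v b x - D b (w k) x)
          = inner_L2 \<Omega> (D b (\<lambda>x. u x - w k x)) (D b (\<lambda>x. u x - w k x))"
        by (intro inner_L2_cong_AE L2_diff v(1) W12D w d b)
      then show ?thesis using v(2)[OF b, of k] by simp
    qed
    then have "inner_grad \<Omega> (\<lambda>x. u x - w k x) (\<lambda>x. u x - w k x) \<le> DIM('a) * (C / 4 ^ k)"
      unfolding inner_grad_eq_sum[OF d d] by (intro sum_bounded_above)
    with u(2)[of k] show ?thesis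
      by (simp add: inner_W12_def ring_distribs add_divide_distrib)
  qed
  with uW show ?thesis by blast
qed

lemma W12_0_zero: "(\<lambda>_. 0) \<in> W12_0 \<Omega>"
proof -
  have t: "(\<lambda>_. 0) \<in> test_functions \<Omega>"
    by (simp add: test_functions_def Ck_const)
  have "norm_W12 \<Omega> (\<lambda>x. 0 - 0) = 0"
    \<comment> \<open>For the zero function the expansion reads q = q + 2 q + q, so q = 0 whichever
      weak derivative of zero was chosen.\<close>
    using inner_grad_square_add_cmult[OF test_W12(1)[OF t] test_W12(1)[OF t], of 1]
    by (simp add: norm_W12_def inner_W12_def inner_L2_def)
  then show ?thesis
    unfolding W12_0_def using test_W12(1)[OF t] t by force
qed

section \<open>The Dirichlet problem\<close>

lemma admissible_add_cmult:
  assumes "u \<in> admissible \<Omega> g" "h \<in> W12_0 \<Omega>"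
  shows "(\<lambda>x. u x + c * h x) \<in> admissible \<Omega> g"
proof -
  have "(\<lambda>x. (u x - g x) + c * h x) \<in> W12_0 \<Omega>"
    using assms by (intro W12_0_add_cmult) (auto simp: admissible_def)
  then show ?thesis
    using assms by (auto simp: admissible_def algebra_simps intro: W12_add_cmult(1) W12_0_W12)
qed

lemma admissible_diff:
  assumes "u \<in> admissible \<Omega> g" "v \<in> admissible \<Omega> g"
  shows "(\<lambda>x. u x - v x) \<in> W12_0 \<Omega>"
proof -
  have "(\<lambda>x. (u x - g x) - (v x - g x)) \<in> W12_0 \<Omega>"
    by (rule W12_0_diff) (use assms in \<open>auto simp: admissible_def\<close>)
  then show ?thesis by simp
qed

lemma dirichlet_functional_eq:
  "dirichlet_functional \<Omega> f w = 1 / 2 * inner_grad \<Omega> w w - inner_L2 \<Omega> f w"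
  by (simp add: dirichlet_functional_def norm_grad_def inner_grad_nonneg)

text \<open>An exact second-order expansion along a line: the linear coefficient is the defect in
  the critical equation, the quadratic one is nonnegative. The equivalence of the problems, the
  lower bound and the convergence of minimizing sequences are all read off from it.\<close>

lemma dirichlet_functional_add_cmult:
  assumes "f \<in> L2 \<Omega>" "u \<in> W12 \<Omega>" "h \<in> W12 \<Omega>"
  shows "dirichlet_functional \<Omega> f (\<lambda>x. u x + c * h x) = dirichlet_functional \<Omega> f u +
    c * (inner_grad \<Omega> u h - inner_L2 \<Omega> f h) + c\<^sup>2 / 2 * inner_grad \<Omega> h h"
proof -
  have "inner_L2 \<Omega> f (\<lambda>x. u x + c * h x) = inner_L2 \<Omega> f u + c * inner_L2 \<Omega> f h"
    using inner_L2_add_cmult_left[OF W12D(1)[OF assms(2)] W12D(1)[OF assms(3)] assms(1)]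
    by (simp add: inner_L2_commute[of \<Omega> f])
  then show ?thesis
    by (simp add: dirichlet_functional_eq inner_grad_square_add_cmult[OF assms(2,3)] algebra_simps)
qed

text \<open>At a critical point the linear term vanishes and the remaining quadratic term cannot
  lower the value. Conversely, a quadratic polynomial in the step that is nonnegative and vanishes
  at 0 has no linear term.\<close>

lemma minimum_problem_iff_critical_equation:
  assumes f: "f \<in> L2 \<Omega>"
  shows "solves_minimum_problem \<Omega> f g u \<longleftrightarrow> solves_critical_equation \<Omega> f g u"
proof
  assume "solves_critical_equation \<Omega> f g u"
  then have u: "u \<in> admissible \<Omega> g" and crit: "\<And>\<phi>. \<phi> \<in> W12_0 \<Omega> \<Longrightarrow> inner_grad \<Omega> u \<phi> = inner_L2 \<Omega> f \<phi>"
    by (auto simp: solves_critical_equation_def)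
  have "dirichlet_functional \<Omega> f u \<le> dirichlet_functional \<Omega> f w" if w: "w \<in> admissible \<Omega> g" for w
  proof -
    have h: "(\<lambda>x. w x - u x) \<in> W12_0 \<Omega>" by (rule admissible_diff[OF w u])
    have "dirichlet_functional \<Omega> f (\<lambda>x. u x + 1 * (w x - u x)) \<ge> dirichlet_functional \<Omega> f u"
      using u crit[OF h] inner_grad_nonneg[of "\<lambda>x. w x - u x"]
      by (subst dirichlet_functional_add_cmult[OF f _ W12_0_W12[OF h]]) (auto simp: admissible_def)
    then show ?thesis by simp
  qed
  with u show "solves_minimum_problem \<Omega> f g u"
    by (simp add: solves_minimum_problem_def)
next
  assume "solves_minimum_problem \<Omega> f g u"
  then have u: "u \<in> admissible \<Omega> g"
    and min: "\<And>w. w \<in> admissible \<Omega> g \<Longrightarrow> dirichlet_functional \<Omega> f u \<le> dirichlet_functional \<Omega> f w"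
    by (auto simp: solves_minimum_problem_def)
  have "inner_grad \<Omega> u \<phi> = inner_L2 \<Omega> f \<phi>" if \<phi>: "\<phi> \<in> W12_0 \<Omega>" for \<phi>
  proof -
    define B where "B = inner_grad \<Omega> u \<phi> - inner_L2 \<Omega> f \<phi>"
    \<comment> \<open>Discriminant criterion with A = 0. The step is taken as 2 t, so that the
      expansion has the form 2 t B + t^2 C with C = 2
      \<open>inner_grad \<Omega> \<phi> \<phi>\<close>.\<close>
    have "B\<^sup>2 \<le> 0 * (2 * inner_grad \<Omega> \<phi> \<phi>)"
    proof (rule square_le_mult_if_quadratic_nonneg)
      fix t :: real
      have "dirichlet_functional \<Omega> f u \<le> dirichlet_functional \<Omega> f (\<lambda>x. u x + 2 * t * \<phi> x)"
        by (rule min[OF admissible_add_cmult[OF u \<phi>]])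
      also have "\<dots> = dirichlet_functional \<Omega> f u + 2 * t * B + (2 * t)\<^sup>2 / 2 * inner_grad \<Omega> \<phi> \<phi>"
        unfolding B_def using u \<phi>
        by (intro dirichlet_functional_add_cmult f) (auto simp: admissible_def W12_0_W12)
      finally show "0 \<le> 0 + 2 * t * B + t\<^sup>2 * (2 * inner_grad \<Omega> \<phi> \<phi>)"
        by (simp add: power2_eq_square)
    qed (simp add: inner_grad_nonneg)
    then show ?thesis by (simp add: B_def)
  qed
  with u show "solves_critical_equation \<Omega> f g u"
    by (simp add: solves_critical_equation_def)
qed

lemma critical_equation_unique:
  assumes "f \<in> L2 \<Omega>" and u: "solves_critical_equation \<Omega> f g u" and v: "solves_critical_equation \<Omega> f g v"
  shows "ae_eq_on \<Omega> u v"
proof -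
  have uW: "u \<in> W12 \<Omega>" and vW: "v \<in> W12 \<Omega>"
    using u v by (auto simp: solves_critical_equation_def admissible_def)
  define h where "h x = u x - v x" for x
  have h: "h \<in> W12_0 \<Omega>"
    unfolding h_def[abs_def] using u v by (intro admissible_diff) (auto simp: solves_critical_equation_def)
  have "inner_grad \<Omega> (\<lambda>x. u x + (-1) * v x) h = inner_grad \<Omega> u h + (-1) * inner_grad \<Omega> v h"
    by (rule inner_grad_add_cmult_left[OF uW vW W12_0_W12[OF h]])
  also have "\<dots> = 0"
    using u v h by (simp add: solves_critical_equation_def)
  finally have "inner_grad \<Omega> h h = 0" by (simp add: h_def[abs_def])
  then have "inner_L2 \<Omega> h h = 0"
    using Poincare_W12_0 h inner_L2_nonneg[of \<Omega> h] by force
  moreover have "integrable M (\<lambda>x. (h x)\<^sup>2)"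
    by (rule L2D(2)[OF W12D(1)[OF W12_0_W12[OF h]]])
  ultimately have "AE x in M. (h x)\<^sup>2 = 0"
    by (subst integral_nonneg_eq_0_iff_AE[symmetric]) (auto simp: inner_L2_def power2_eq_square)
  then show ?thesis
    by (simp add: ae_eq_on_def h_def)
qed

text \<open>\<open>ex1_W12\<close> asks that the solutions fill a whole class, so every
  representative has to be a solution too.\<close>

lemma critical_equation_cong_AE:
  assumes u: "solves_critical_equation \<Omega> f g u" and ae: "ae_eq_on \<Omega> u v"
  shows "solves_critical_equation \<Omega> f g v"
proof -
  have ae: "AE x in M. u x = v x" using ae by (simp add: ae_eq_on_def)
  have uW: "u \<in> W12 \<Omega>" and ug: "(\<lambda>x. u x - g x) \<in> W12_0 \<Omega>"
    using u by (auto simp: solves_critical_equation_def admissible_def)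
  have "AE x in M. u x - g x = v x - g x"
    using ae by eventually_elim simp
  then have "v \<in> admissible \<Omega> g"
    using W12_cong_AE(1)[OF uW ae] W12_0_cong_AE[OF ug] by (simp add: admissible_def)
  moreover have "inner_grad \<Omega> v \<phi> = inner_L2 \<Omega> f \<phi>" if "\<phi> \<in> W12_0 \<Omega>" for \<phi>
    using inner_grad_cong_AE[OF uW W12_0_W12[OF that] ae] u that
    by (simp add: solves_critical_equation_def)
  ultimately show ?thesis by (simp add: solves_critical_equation_def)
qed

text \<open>Expanding around \<open>g\<close>, let n be the gradient norm of h = w - g.
  Cauchy-Schwarz, together with the Poincare inequality for h, bounds the linear term by a multiple
  of n, which the quadratic term n^2 / 2 outweighs.\<close>

lemma dirichlet_functional_bounded_below:
  assumes f: "f \<in> L2 \<Omega>" and g: "g \<in> W12 \<Omega>"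
  shows "\<exists>m. \<forall>w\<in>admissible \<Omega> g. m \<le> dirichlet_functional \<Omega> f w"
proof -
  obtain C where C: "C \<ge> 0" "\<And>u. u \<in> W12_0 \<Omega> \<Longrightarrow> inner_L2 \<Omega> u u \<le> C * inner_grad \<Omega> u u"
    using Poincare_W12_0 by blast
  define F where "F = inner_L2 \<Omega> f f"
  define G where "G = inner_grad \<Omega> g g"
  have nn: "0 \<le> F" "0 \<le> G" by (auto simp: F_def G_def inner_L2_nonneg inner_grad_nonneg)
  have "dirichlet_functional \<Omega> f g - (G + C * F) \<le> dirichlet_functional \<Omega> f w" if w: "w \<in> admissible \<Omega> g" for w
  proof -
    define h where "h x = w x - g x" for x
    have h: "h \<in> W12_0 \<Omega>" and hW: "h \<in> W12 \<Omega>"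
      using w by (auto simp: admissible_def h_def[abs_def] W12_0_W12)
    define n where "n = sqrt (inner_grad \<Omega> h h)"
    have n: "n\<^sup>2 = inner_grad \<Omega> h h" "0 \<le> n" by (auto simp: n_def inner_grad_nonneg)
    have "(inner_grad \<Omega> g h)\<^sup>2 \<le> (sqrt G * n)\<^sup>2"
      using inner_grad_Cauchy_Schwarz[OF g hW] nn by (simp add: power_mult_distrib n G_def)
    then have 1: "\<bar>inner_grad \<Omega> g h\<bar> \<le> sqrt G * n"
      using nn n by (intro power2_le_iff_abs_le[THEN iffD1]) auto
    have "(inner_L2 \<Omega> f h)\<^sup>2 \<le> F * inner_L2 \<Omega> h h"
      using inner_L2_Cauchy_Schwarz[OF f W12D(1)[OF hW]] by (simp add: F_def)
    also have "\<dots> \<le> F * (C * n\<^sup>2)"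
      using C(2)[OF h] nn by (intro mult_left_mono) (auto simp: n)
    also have "\<dots> = (sqrt (C * F) * n)\<^sup>2"
      using C(1) nn by (simp add: power_mult_distrib)
    finally have 2: "\<bar>inner_L2 \<Omega> f h\<bar> \<le> sqrt (C * F) * n"
      using C(1) nn n by (intro power2_le_iff_abs_le[THEN iffD1]) auto
    \<comment> \<open>Each of the two linear terms may consume n^2 / 4, half of the available n^2 /
      2; what remains is the constant G + C F.\<close>
    have "0 \<le> (sqrt G - n / 2)\<^sup>2" "0 \<le> (sqrt (C * F) - n / 2)\<^sup>2" by simp_all
    then have "sqrt G * n \<le> G + n\<^sup>2 / 4" "sqrt (C * F) * n \<le> C * F + n\<^sup>2 / 4"
      using C(1) nn by (simp_all add: power2_diff power_divide)
    with 1 2 have "- (G + C * F) \<le> 1 * (inner_grad \<Omega> g h - inner_L2 \<Omega> f h) + 1\<^sup>2 / 2 * n\<^sup>2"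
      by (simp add: abs_le_iff)
    also have "\<dots> = dirichlet_functional \<Omega> f (\<lambda>x. g x + 1 * h x) - dirichlet_functional \<Omega> f g"
      by (subst dirichlet_functional_add_cmult[OF f g hW]) (simp add: n)
    also have "(\<lambda>x. g x + 1 * h x) = w" by (auto simp: h_def)
    finally show ?thesis by simp
  qed
  then show ?thesis by blast
qed

lemma minimum_problem_solvable:
  assumes f: "f \<in> L2 \<Omega>" and g: "g \<in> W12 \<Omega>"
  shows "\<exists>u. solves_minimum_problem \<Omega> f g u"
proof -
  let ?J = "dirichlet_functional \<Omega> f" and ?A = "admissible \<Omega> g"
  have gA: "g \<in> ?A" using g W12_0_zero by (simp add: admissible_def)
  define I where "I = Inf (?J ` ?A)"
  have bdd: "bdd_below (?J ` ?A)"
    using dirichlet_functional_bounded_below[OF f g] by (auto simp: bdd_below_def)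
  have I: "I \<le> ?J w" if "w \<in> ?A" for w
    unfolding I_def using bdd that by (intro cInf_lower) auto
  \<comment> \<open>This rate makes the minimizing sequence Cauchy at exactly the speed that
    \<open>W12_complete\<close> expects.\<close>
  have "\<exists>w\<in>?A. ?J w < I + 1 / 4 ^ k" for k :: nat
  proof -
    have "Inf (?J ` ?A) < I + 1 / 4 ^ k" by (simp add: I_def)
    then show ?thesis
      using gA bdd by (subst (asm) cInf_less_iff) auto
  qed
  then obtain w where w: "\<And>k. w k \<in> ?A" "\<And>k. ?J (w k) < I + 1 / 4 ^ k" by metis
  have wW: "w k \<in> W12 \<Omega>" for k using w(1) by (simp add: admissible_def)
  obtain C where C: "C \<ge> 0" "\<And>u. u \<in> W12_0 \<Omega> \<Longrightarrow> inner_L2 \<Omega> u u \<le> C * inner_grad \<Omega> u u"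
    using Poincare_W12_0 by blast
  have cauchy: "inner_W12 \<Omega> (\<lambda>x. w j x - w k x) (\<lambda>x. w j x - w k x) \<le> (C + 1) * 8 / 4 ^ k" if "k \<le> j" for j k
  proof -
    define h where "h x = w j x - w k x" for x
    have h: "h \<in> W12_0 \<Omega>" unfolding h_def[abs_def] by (rule admissible_diff[OF w(1) w(1)])
    \<comment> \<open>Parallelogram identity, applied to the midpoint of \<open>w j\<close> and \<open>w k\<close>.\<close>
    define X where "X = inner_grad \<Omega> (w k) h - inner_L2 \<Omega> f h"
    note J = dirichlet_functional_add_cmult[OF f wW W12_0_W12[OF h], of k, folded X_def]
    have "(\<lambda>x. w k x + 1 * h x) = w j" by (auto simp: h_def)
    with J[of 1] have "?J (w j) = ?J (w k) + X + inner_grad \<Omega> h h / 2"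
      by simp
    moreover have "I \<le> ?J (\<lambda>x. w k x + 1/2 * h x)"
      by (rule I[OF admissible_add_cmult[OF w(1) h]])
    then have "I \<le> ?J (w k) + 1/2 * X + inner_grad \<Omega> h h / 8"
      unfolding J by (simp add: power2_eq_square)
    \<comment> \<open>\<open>X\<close> cancels: the sum of the two end values minus twice the
      midpoint value is a quarter of \<open>inner_grad \<Omega> h h\<close>.\<close>
    ultimately have "inner_grad \<Omega> h h \<le> 4 * (?J (w j) + ?J (w k) - 2 * I)"
      by (simp add: field_simps)
    also have "\<dots> \<le> 4 * (1 / 4 ^ j + 1 / 4 ^ k)"
      using add_strict_mono[OF w(2)[of j] w(2)[of k]] by simp
    also have "\<dots> \<le> 8 / 4 ^ k"
    proof -
      have "1 / (4::real) ^ j \<le> 1 / 4 ^ k"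
        by (intro divide_left_mono power_increasing that) auto
      then show ?thesis by simp
    qed
    finally have *: "inner_grad \<Omega> h h \<le> 8 / 4 ^ k" .
    \<comment> \<open>Minimality controls only gradients; the difference \<open>h\<close> vanishes
      on the border, so the Poincare inequality supplies the full norm.\<close>
    have "inner_W12 \<Omega> h h \<le> (C + 1) * inner_grad \<Omega> h h"
      using C(2)[OF h] by (simp add: inner_W12_def algebra_simps)
    also have "\<dots> \<le> (C + 1) * (8 / 4 ^ k)"
      using C(1) * by (intro mult_left_mono) auto
    finally show ?thesis by (simp add: h_def[abs_def])
  qed
  obtain u K where u: "u \<in> W12 \<Omega>"
    and K: "\<And>k. inner_W12 \<Omega> (\<lambda>x. u x - w k x) (\<lambda>x. u x - w k x) \<le> K / 4 ^ k"
    using W12_complete[OF wW cauchy] by blast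
  have K0: "0 \<le> K"
    using order_trans[OF inner_W12_nonneg K[of 0]] by simp
  have quarter: "(\<lambda>k. c / 4 ^ k) \<longlonglongrightarrow> 0" for c :: real
    using tendsto_mult_right_zero[OF LIMSEQ_power_zero[of "1/4::real"], of c] by (simp add: power_one_over)
  have "(\<lambda>x. u x - g x) \<in> W12_0 \<Omega>"
  proof (rule W12_0_closed[OF W12_diff[OF u g]])
    fix \<epsilon> :: real assume "\<epsilon> > 0"
    then obtain k where "K / 4 ^ k < \<epsilon>"
      using order_tendstoD(2)[OF quarter[of K]] eventually_happens[of _ sequentially] by auto
    with K[of k] have "inner_W12 \<Omega> (\<lambda>x. (u x - g x) - (w k x - g x)) (\<lambda>x. (u x - g x) - (w k x - g x)) < \<epsilon>"
      by simp
    then show "\<exists>h\<in>W12_0 \<Omega>. inner_W12 \<Omega> (\<lambda>x. u x - g x - h x) (\<lambda>x. u x - g x - h x) < \<epsilon>"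
      using w(1)[of k] by (intro bexI[of _ "\<lambda>x. w k x - g x"]) (auto simp: admissible_def)
  qed
  with u have uA: "u \<in> ?A" by (simp add: admissible_def)
  have "?J u \<le> I"
  proof (rule LIMSEQ_le_const)
    \<comment> \<open>Expanding around \<open>u\<close>, the quadratic term has the favourable sign,
      so only the linear term in h = u - w k is to be bounded. Cauchy-Schwarz bounds it by
      \<open>L\<close> times 2^(-k).\<close>
    define L where "L = sqrt (inner_grad \<Omega> u u * K) + sqrt (inner_L2 \<Omega> f f * K)"
    show "(\<lambda>k. I + 1 / 4 ^ k + L * (1/2) ^ k) \<longlonglongrightarrow> I"
      using tendsto_add[OF tendsto_add[OF tendsto_const[of I] quarter[of 1]]
          tendsto_mult_right_zero[OF LIMSEQ_power_zero[of "1/2::real"], of L]] by simp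
    have "?J u \<le> I + 1 / 4 ^ k + L * (1/2) ^ k" for k
    proof -
      define h where "h x = u x - w k x" for x
      have hW: "h \<in> W12 \<Omega>" unfolding h_def[abs_def] by (rule W12_diff[OF u wW])
      have b: "inner_grad \<Omega> h h \<le> K * ((1/2) ^ k)\<^sup>2" "inner_L2 \<Omega> h h \<le> K * ((1/2) ^ k)\<^sup>2"
        using K[of k] inner_grad_nonneg[of h] inner_L2_nonneg[of \<Omega> h]
        by (simp_all add: inner_W12_def h_def[abs_def] half_power_squared)
      have "(inner_grad \<Omega> u h)\<^sup>2 \<le> inner_grad \<Omega> u u * (K * ((1/2) ^ k)\<^sup>2)"
        by (rule order_trans[OF inner_grad_Cauchy_Schwarz[OF u hW] mult_left_mono[OF b(1) inner_grad_nonneg]])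
      also have "\<dots> = (sqrt (inner_grad \<Omega> u u * K) * (1/2) ^ k)\<^sup>2"
        using K0 inner_grad_nonneg[of u] by (simp add: power_mult_distrib)
      finally have 1: "\<bar>inner_grad \<Omega> u h\<bar> \<le> sqrt (inner_grad \<Omega> u u * K) * (1/2) ^ k"
        using K0 inner_grad_nonneg[of u] by (intro power2_le_iff_abs_le[THEN iffD1]) auto
      have "(inner_L2 \<Omega> f h)\<^sup>2 \<le> inner_L2 \<Omega> f f * (K * ((1/2) ^ k)\<^sup>2)"
        by (rule order_trans[OF inner_L2_Cauchy_Schwarz[OF f W12D(1)[OF hW]] mult_left_mono[OF b(2) inner_L2_nonneg]])
      also have "\<dots> = (sqrt (inner_L2 \<Omega> f f * K) * (1/2) ^ k)\<^sup>2"
        using K0 inner_L2_nonneg[of \<Omega> f] by (simp add: power_mult_distrib)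
      finally have 2: "\<bar>inner_L2 \<Omega> f h\<bar> \<le> sqrt (inner_L2 \<Omega> f f * K) * (1/2) ^ k"
        using K0 inner_L2_nonneg[of \<Omega> f] by (intro power2_le_iff_abs_le[THEN iffD1]) auto
      have "(\<lambda>x. u x + (-1) * h x) = w k" by (auto simp: h_def)
      with dirichlet_functional_add_cmult[OF f u hW, of "-1"]
      have "?J u \<le> ?J (w k) + (inner_grad \<Omega> u h - inner_L2 \<Omega> f h)"
        using inner_grad_nonneg[of h] by simp
      also have "\<dots> \<le> I + 1 / 4 ^ k + L * (1/2) ^ k"
        using 1 2 w(2)[of k] by (simp add: L_def abs_le_iff distrib_right)
      finally show ?thesis .
    qed
    then show "\<exists>N. \<forall>k\<ge>N. ?J u \<le> I + 1 / 4 ^ k + L * (1/2) ^ k" by blast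
  qed
  with uA I show ?thesis
    by (auto simp: solves_minimum_problem_def intro: order_trans)
qed

end

theorem mainTheorem1:
  fixes \<Omega> :: "(real ^ 'n) set" and f g :: "real ^ 'n \<Rightarrow> real"
  assumes "\<Omega> \<noteq> {}" and "bounded \<Omega>" and "open \<Omega>"
    and "f \<in> L2 \<Omega>" and "g \<in> W12 \<Omega>"
  shows "ex1_W12 \<Omega> (solves_minimum_problem \<Omega> f g) \<and>
    ex1_W12 \<Omega> (solves_critical_equation \<Omega> f g) \<and>
    (\<forall>u v. solves_minimum_problem \<Omega> f g u \<and> solves_critical_equation \<Omega> f g v
       \<longrightarrow> ae_eq_on \<Omega> u v)"
proof -
  interpret bounded_open \<Omega> using assms by unfold_locales
  \<comment> \<open>Both problems have the same solutions, so existence is taken from the minimum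
    problem and uniqueness from the critical equation.\<close>
  note iff = minimum_problem_iff_critical_equation[OF \<open>f \<in> L2 \<Omega>\<close>, of g]
  have unique: "ae_eq_on \<Omega> u v"
    if "solves_critical_equation \<Omega> f g u" "solves_critical_equation \<Omega> f g v" for u v
    using critical_equation_unique[OF \<open>f \<in> L2 \<Omega>\<close> that] .
  obtain u where u: "solves_critical_equation \<Omega> f g u"
    using minimum_problem_solvable[OF \<open>f \<in> L2 \<Omega>\<close> \<open>g \<in> W12 \<Omega>\<close>] iff by blast
  have "solves_critical_equation \<Omega> f g v \<longleftrightarrow> ae_eq_on \<Omega> v u" for v
  proof
    assume "ae_eq_on \<Omega> v u"
    then have "ae_eq_on \<Omega> u v" by (simp add: ae_eq_on_def eq_commute)
    with u show "solves_critical_equation \<Omega> f g v" by (rule critical_equation_cong_AE)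
  qed (rule unique[OF _ u])
  moreover have "u \<in> W12 \<Omega>"
    using u by (simp add: solves_critical_equation_def admissible_def)
  ultimately have "ex1_W12 \<Omega> (solves_critical_equation \<Omega> f g)"
    unfolding ex1_W12_def by blast
  then show ?thesis
    using unique by (simp add: ex1_W12_def iff)
qed

end
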